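(* Let $D\subset\mathbb{C}$ be a domain and let $a\in\partial D$. Let $s_D$ denote the squeezing function of $D$ and $\delta_D(z)$ the distance from $z\in D$ to $\partial D$. (a) If $a$ is a Dini-smooth boundary point of $D$, then $$\limsup_{z\to a}\frac{1-s_D(z)}{\delta_D(z)}<\infty.$$ (b) If $a$ is a $\mathcal{C}^1$-smooth boundary point of $D$, then $$\lim_{z\to a}\frac{1-s_D(z)}{\delta_D(z)^\alpha}=0\quad\text{for every } \alpha<1.$$ Here the limits are taken over $z\in D$.
   Context: A domain is a non-empty connected open set; $D$ is not assumed to be bounded. Squeezing function: let $\mathbb{B}_n$ denote the open unit ball in $\mathbb{C}^n$ (here $n=1$, so $\mathbb{B}_1$ is the open unit disc). Let $M$ be an $n$-dimensional complex manifold (for example a domain in $\mathbb{C}^n$) and $p\in M$. For a holomorphic embedding $f:M\to\mathbb{B}_n$ with $f(p)=0$, set $s_M(f,p)=\sup\{r>0: r\mathbb{B}_n\subset f(M)\}$. The squeezing function of $M$ is $s_M(p)=\sup_f s_M(f,p)$, the supremum being over all such $f$, if such $f$ exist, and $s_M(p)=0$ otherwise. Smoothness: a $\mathcal{C}^1$-smooth bounded domain $G$ is said to be Dini-smooth if the inner unit normal vector $n$ to $\partial G$ is Dini-continuous, meaning that $\int_0^1\frac{\omega(t)}{t}\,dt<\infty$, where $\omega(t)=\sup\{|n_x-n_y|: |x-y|<t,\ x,y\in\partial G\}$ is the modulus of continuity of $n$. A boundary point $a$ of a domain $D$ is called Dini-smooth if there exists a neighborhood $U$ of $a$ such that $D\cap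 U$ is a Dini-smooth domain. Likewise, $a$ is called a $\mathcal{C}^1$-smooth boundary point if there exists a neighborhood $U$ of $a$ such that $D\cap U$ is a $\mathcal{C}^1$-smooth bounded domain. *)

theory Defs
  imports "HOL-Complex_Analysis.Complex_Analysis"
begin

definition is_domain :: "complex set \<Rightarrow> bool" where
  "is_domain D \<longleftrightarrow> open D \<and> connected D \<and> D \<noteq> {}"

definition holomorphic_embedding :: "(complex \<Rightarrow> complex) \<Rightarrow> complex set \<Rightarrow> complex set \<Rightarrow> bool" where
  "holomorphic_embedding f M N \<longleftrightarrow>
     f holomorphic_on M \<and> f ` M \<subseteq> N \<and> (\<forall>z\<in>M. deriv f z \<noteq> 0) \<and>
     (\<exists>g. homeomorphism M (f ` M) f g)"

definition squeezing_embeddings :: "complex set \<Rightarrow> complex \<Rightarrow> (complex \<Rightarrow> complex) set" where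
  "squeezing_embeddings M p = {f. holomorphic_embedding f M (ball 0 1) \<and> f p = 0}"

definition squeezing_radius :: "complex set \<Rightarrow> (complex \<Rightarrow> complex) \<Rightarrow> real" where
  "squeezing_radius M f = Sup {r. r > 0 \<and> ball 0 r \<subseteq> f ` M}"

definition squeezing_function :: "complex set \<Rightarrow> complex \<Rightarrow> real" where
  "squeezing_function M p =
     (if squeezing_embeddings M p = {} then 0
      else (SUP f\<in>squeezing_embeddings M p. squeezing_radius M f))"

text \<open>A local defining function \<open>\<rho>\<close> of class \<open>C\<^sup>1\<close> for \<open>G\<close> on the open set \<open>U\<close>, with gradient
  field \<open>g\<close>. Since \<open>g\<close> does not vanish, \<open>frontier G \<inter> U\<close> is exactly the zero set of \<open>\<rho>\<close> in \<open>U\<close>, so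
  \<open>G\<close> lies locally on one side of its boundary only (slits are excluded).\<close>
definition C1_defining_function ::
    "complex set \<Rightarrow> complex set \<Rightarrow> (complex \<Rightarrow> real) \<Rightarrow> (complex \<Rightarrow> complex) \<Rightarrow> bool" where
  "C1_defining_function G U \<rho> g \<longleftrightarrow>
     open U \<and> (\<forall>z\<in>U. GDERIV \<rho> z :> g z) \<and> continuous_on U g \<and> (\<forall>z\<in>U. g z \<noteq> 0) \<and>
     G \<inter> U = {z \<in> U. \<rho> z < 0}"

definition C1_smooth_bounded_domain :: "complex set \<Rightarrow> bool" where
  "C1_smooth_bounded_domain G \<longleftrightarrow>
     is_domain G \<and> bounded G \<and>
     (\<forall>x\<in>frontier G. \<exists>U \<rho> g. x \<in> U \<and> C1_defining_function G U \<rho> g)"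

definition is_inner_unit_normal :: "complex set \<Rightarrow> complex \<Rightarrow> complex \<Rightarrow> bool" where
  "is_inner_unit_normal G x v \<longleftrightarrow>
     (\<exists>U \<rho> g. x \<in> U \<and> C1_defining_function G U \<rho> g \<and> v = - sgn (g x))"

definition inner_unit_normal :: "complex set \<Rightarrow> complex \<Rightarrow> complex" where
  "inner_unit_normal G x = (THE v. is_inner_unit_normal G x v)"

lemma gderiv_neg_direction:
  assumes "GDERIV \<rho> x :> (d::complex)" "v \<bullet> d < 0" "\<rho> x = 0"
  shows "\<forall>\<^sub>F t in at_right 0. \<rho> (x + t *\<^sub>R v) < 0"
proof -
  have line: "((\<lambda>t::real. x + t *\<^sub>R v) has_derivative (\<lambda>t. t *\<^sub>R v)) (at 0)"
    by (auto intro!: derivative_eq_intros)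
  have "(\<rho> has_derivative (\<lambda>h. h \<bullet> d)) (at (x + 0 *\<^sub>R v))"
    using assms(1) by (simp add: gderiv_def)
  from diff_chain_at[OF line this]
  have "((\<lambda>t. \<rho> (x + t *\<^sub>R v)) has_real_derivative v \<bullet> d) (at 0)"
    by (simp add: has_field_derivative_def o_def mult_commute_abs)
  from DERIV_neg_dec_right[OF this assms(2)] obtain e
    where "e > 0" "\<And>h. 0 < h \<Longrightarrow> h < e \<Longrightarrow> \<rho> (x + h *\<^sub>R v) < 0"
    using assms(3) by auto
  then show ?thesis
    by (auto simp: eventually_at_right intro: exI[of _ e])
qed

lemma C1_defining_function_zero:
  assumes "C1_defining_function G U \<rho> g" "x \<in> U" "x \<in> frontier G" "open G"
  shows "\<rho> x = 0"
proof (rule ccontr)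
  assume nz: "\<rho> x \<noteq> 0"
  have "x \<notin> G" "x \<in> closure G"
    using assms(3,4) by (auto simp: frontier_def interior_open)
  then have pos: "\<rho> x > 0"
    using nz assms(1,2) unfolding C1_defining_function_def by force
  have "isCont \<rho> x"
    using assms(1,2) unfolding C1_defining_function_def gderiv_def
    by (meson has_derivative_continuous)
  then have "\<forall>\<^sub>F z in nhds x. \<rho> z > 0"
    using pos by (metis order_tendstoD(1) tendsto_at_iff_tendsto_nhds isCont_def)
  moreover have "\<forall>\<^sub>F z in nhds x. z \<in> U"
    using assms(1,2) unfolding C1_defining_function_def by (auto simp: eventually_nhds)
  ultimately have "\<forall>\<^sub>F z in nhds x. z \<notin> G"
    by eventually_elim (use assms(1) in \<open>force simp: C1_defining_function_def\<close>)
  then obtain S where "open S" "x \<in> S" "S \<inter> G = {}"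
    by (auto simp: eventually_nhds)
  then show False
    using \<open>x \<in> closure G\<close> by (auto simp: closure_iff_nhds_not_empty)
qed

lemma is_inner_unit_normal_unique:
  assumes "open G" "x \<in> frontier G" "is_inner_unit_normal G x v" "is_inner_unit_normal G x w"
  shows "v = w"
proof (rule ccontr)
  assume ne: "v \<noteq> w"
  obtain U \<rho> g where 1: "x \<in> U" "C1_defining_function G U \<rho> g" "v = - sgn (g x)"
    using assms(3) by (auto simp: is_inner_unit_normal_def)
  obtain V \<sigma> h where 2: "x \<in> V" "C1_defining_function G V \<sigma> h" "w = - sgn (h x)"
    using assms(4) by (auto simp: is_inner_unit_normal_def)
  have nz: "g x \<noteq> 0" "h x \<noteq> 0" and op: "open U" "open V"
    using 1 2 by (auto simp: C1_defining_function_def)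
  have un: "v \<bullet> v = 1" "w \<bullet> w = 1"
    using nz by (simp_all add: 1 2 dot_square_norm norm_sgn)
  define u where "u = v - w"
  have "0 < u \<bullet> u" using ne by (simp add: u_def)
  then have vw: "v \<bullet> w < 1"
    using un by (simp add: u_def inner_diff inner_commute)
  have "g x = - (norm (g x) *\<^sub>R v)" "h x = - (norm (h x) *\<^sub>R w)"
    using nz by (simp_all add: 1 2 sgn_div_norm)
  then have "u \<bullet> g x = - norm (g x) * (u \<bullet> v)" "(-u) \<bullet> (- h x) = - norm (h x) * (u \<bullet> w)"
    by (metis inner_minus_right inner_scaleR_right mult_minus_left,
        metis inner_minus_right inner_minus_left inner_scaleR_right mult_minus_left minus_minus)
  moreover have "u \<bullet> v > 0" "u \<bullet> w < 0"
    using un vw by (simp_all add: u_def inner_diff inner_commute)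
  ultimately have d: "u \<bullet> g x < 0" "u \<bullet> (- h x) < 0"
    using nz by (auto simp: mult_less_0_iff zero_less_mult_iff)
  have "\<rho> x = 0" "\<sigma> x = 0"
    using C1_defining_function_zero[OF 1(2,1) assms(2,1)]
      C1_defining_function_zero[OF 2(2,1) assms(2,1)] by simp_all
  have A: "\<forall>\<^sub>F t in at_right 0. \<rho> (x + t *\<^sub>R u) < 0"
    using 1 d \<open>\<rho> x = 0\<close> by (intro gderiv_neg_direction) (auto simp: C1_defining_function_def)
  have "GDERIV (\<lambda>z. - \<sigma> z) x :> - h x"
    using 2 by (auto simp: C1_defining_function_def intro: GDERIV_minus)
  then have B: "\<forall>\<^sub>F t in at_right 0. - \<sigma> (x + t *\<^sub>R u) < 0"
    using gderiv_neg_direction[of "\<lambda>z. - \<sigma> z", OF _ d(2)] \<open>\<sigma> x = 0\<close> by simp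
  have "((\<lambda>t::real. x + t *\<^sub>R u) \<longlongrightarrow> x + 0 *\<^sub>R u) (at_right 0)"
    by (intro tendsto_intros)
  from topological_tendstoD[OF this, of "U \<inter> V"]
  have C: "\<forall>\<^sub>F t in at_right 0. x + t *\<^sub>R u \<in> U \<inter> V"
    using 1(1) 2(1) op by auto
  from A B C have "\<forall>\<^sub>F t::real in at_right 0. False"
  proof eventually_elim
    case (elim t)
    let ?y = "x + t *\<^sub>R u"
    have "G \<inter> U = {z \<in> U. \<rho> z < 0}" "G \<inter> V = {z \<in> V. \<sigma> z < 0}"
      using 1(2) 2(2) unfolding C1_defining_function_def by simp_all
    then have "?y \<in> G \<longleftrightarrow> \<rho> ?y < 0" "?y \<in> G \<longleftrightarrow> \<sigma> ?y < 0"
      using elim(3) by blast+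
    with elim(1,2) show False by linarith
  qed
  then show False by simp
qed

lemma inner_unit_normal:
  assumes "C1_smooth_bounded_domain G" "x \<in> frontier G"
  shows "is_inner_unit_normal G x (inner_unit_normal G x)"
proof -
  have op: "open G"
    using assms by (simp add: C1_smooth_bounded_domain_def is_domain_def)
  have "\<exists>v. is_inner_unit_normal G x v"
    using assms unfolding C1_smooth_bounded_domain_def is_inner_unit_normal_def by blast
  then have "\<exists>!v. is_inner_unit_normal G x v"
    using is_inner_unit_normal_unique[OF op assms(2)] by auto
  then show ?thesis
    unfolding inner_unit_normal_def by (rule theI')
qed

definition normal_modulus :: "complex set \<Rightarrow> real \<Rightarrow> real" where
  "normal_modulus G t =
     Sup {norm (inner_unit_normal G x - inner_unit_normal G y) | x y.
            norm (x - y) < t \<and> x \<in> frontier G \<and> y \<in> frontier G}"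

definition Dini_smooth_domain :: "complex set \<Rightarrow> bool" where
  "Dini_smooth_domain G \<longleftrightarrow>
     C1_smooth_bounded_domain G \<and>
     (\<integral>\<^sup>+t\<in>{0<..1}. ennreal (normal_modulus G t / t) \<partial>lborel) < \<infinity>"

definition C1_smooth_boundary_point :: "complex set \<Rightarrow> complex \<Rightarrow> bool" where
  "C1_smooth_boundary_point D a \<longleftrightarrow>
     a \<in> frontier D \<and> (\<exists>U. open U \<and> a \<in> U \<and> C1_smooth_bounded_domain (D \<inter> U))"

definition Dini_smooth_boundary_point :: "complex set \<Rightarrow> complex \<Rightarrow> bool" where
  "Dini_smooth_boundary_point D a \<longleftrightarrow>
     a \<in> frontier D \<and> (\<exists>U. open U \<and> a \<in> U \<and> Dini_smooth_domain (D \<inter> U))"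

definition boundary_dist :: "complex set \<Rightarrow> complex \<Rightarrow> real" where
  "boundary_dist D z = infdist z (frontier D)"

end

theory Submission imports Defs begin

text \<open>
  Since \<open>s\<^sub>D \<le> 1\<close>, only lower bounds for the squeezing function are needed, and these come from
  explicit embeddings. Near a smooth boundary point the part of a small closed disc outside \<open>D\<close> is a
  compact set \<open>K\<close> that is starlike about one of its interior points (\<open>starlike_obstacle\<close>). Its
  complement in the Riemann sphere is simply connected, contains \<open>D\<close>, and agrees with \<open>D\<close> near \<open>a\<close>.
  Restrict its Riemann map to \<open>D\<close> and follow it by the disc automorphism that sends the image of \<open>z\<close>
  to \<open>0\<close>. The values missed by the resulting embedding come from points far from \<open>a\<close>, and their
  moduli are the exponentials of minus the Green function of the complement of \<open>K\<close> at \<open>z\<close> and such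
  points. So \<open>1 - s\<^sub>D(z)\<close> is at most the size of a Green function with pole far from \<open>z\<close>,
  uniformly in the pole.

  A positive harmonic function vanishing on the boundary is dominated by any positive harmonic
  barrier, by the maximum principle. Using the real part of a holomorphic function as barrier, the
  comparison becomes the maximum modulus principle (\<open>squeezing_function_barrier_bound\<close>). The boundary
  values needed for it come from two facts: the modulus of the Riemann map tends to \<open>1\<close> at the
  boundary, and the Schwarz lemma bounds the Green function away from its pole.

  It remains to find barriers at a boundary point \<open>\<zeta>\<close> nearest to \<open>z\<close>. The oscillation of the
  normal limits how far \<open>D\<close> can dip below its tangent line at \<open>\<zeta>\<close> (\<open>inner_normal_ge\<close>). If the
  boundary is merely of class \<open>C\<^sup>1\<close>, then \<open>D\<close> is locally contained in a sector of opening slightly more than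
  \<open>\<pi>\<close>, and a power with exponent \<open>\<beta> < 1\<close> is a barrier of size \<open>\<delta>\<^sup>\<beta>\<close> (\<open>power_barriers\<close>). In the
  Dini-smooth case a finite sum of rational functions, one for each dyadic scale above \<open>\<delta>\<close>, is a
  barrier of size comparable to \<open>\<delta>\<close>, the Dini condition being exactly what bounds the sum of the
  coefficients (\<open>Dini_barriers\<close>).
\<close>

section \<open>Elementary bounds for the squeezing function\<close>

text \<open>The radii competing in a squeezing radius are bounded by \<open>1\<close> because images lie in the unit
  disc, and there is at least one of them by the open mapping theorem; both facts are needed to
  reason with the suprema in the definition.\<close>

lemma squeezing_radius_bounds:
  assumes "f \<in> squeezing_embeddings M p" "open M" "p \<in> M"
  shows "bdd_above {r. r > 0 \<and> ball 0 r \<subseteq> f ` M}" and "squeezing_radius M f \<le> 1"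
proof -
  have hol: "f holomorphic_on M" and sub: "f ` M \<subseteq> ball 0 1" and fp: "f p = 0"
    and inj: "inj_on f M"
    using assms(1)
    by (auto simp: squeezing_embeddings_def holomorphic_embedding_def homeomorphism_def
        intro: inj_on_inverseI)
  let ?S = "{r. r > 0 \<and> ball 0 r \<subseteq> f ` M}"
  have le: "r \<le> 1" if "r \<in> ?S" for r
  proof -
    have "ball (0::complex) r \<subseteq> ball 0 1" using that sub by blast
    with that show ?thesis by (auto simp: ball_subset_ball_iff)
  qed
  then show "bdd_above ?S" by (rule bdd_aboveI)
  have "open (f ` M)"
    using hol assms(2) inj by (rule open_mapping_thm3)
  moreover have "0 \<in> f ` M" using fp assms(3) by force
  ultimately have "?S \<noteq> {}" using open_contains_ball by blast
  then show "squeezing_radius M f \<le> 1"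
    unfolding squeezing_radius_def using le by (rule cSup_least)
qed

lemma squeezing_function_le_1:
  assumes "open M" "p \<in> M"
  shows "squeezing_function M p \<le> 1"
proof (cases "squeezing_embeddings M p = {}")
  case False
  then show ?thesis
    unfolding squeezing_function_def
    using squeezing_radius_bounds(2)[OF _ assms] by (auto intro!: cSUP_least)
qed (simp add: squeezing_function_def)

lemma squeezing_function_ge:
  assumes "open M" "p \<in> M" and f: "f \<in> squeezing_embeddings M p"
    and "r > 0" "ball 0 r \<subseteq> f ` M"
  shows "r \<le> squeezing_function M p"
proof -
  have "r \<le> squeezing_radius M f"
    unfolding squeezing_radius_def
    using squeezing_radius_bounds(1)[OF f assms(1,2)] assms(4,5) by (intro cSup_upper) auto
  also have "\<dots> \<le> (SUP f\<in>squeezing_embeddings M p. squeezing_radius M f)"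
    using f squeezing_radius_bounds(2)[OF _ assms(1,2)] by (intro cSUP_upper bdd_aboveI) auto
  finally show ?thesis using f by (auto simp: squeezing_function_def)
qed

lemma injective_holomorphic_embedding:
  assumes "open M" "f holomorphic_on M" "inj_on f M" "f ` M \<subseteq> N"
  shows "holomorphic_embedding f M N"
proof -
  obtain g where g: "g holomorphic_on (f ` M)" "\<And>z. z \<in> M \<Longrightarrow> g (f z) = z"
    using holomorphic_has_inverse[OF assms(2,1,3)] by metis
  have "homeomorphism M (f ` M) f g"
    unfolding homeomorphism_def using g assms(2)
    by (auto simp: holomorphic_on_imp_continuous_on image_iff)
  then show ?thesis
    unfolding holomorphic_embedding_def
    using assms holomorphic_injective_imp_regular by blast
qed

section \<open>Maximum principle with boundary limits\<close>

text \<open>The barrier argument compares functions that do not extend continuously to the boundary, so the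
  maximum principle is needed with a bound on boundary upper limits only. It follows from the version for
  functions continuous up to the boundary, applied to a superlevel set \<open>{|F| > B + e}\<close>: the limit
  hypothesis keeps the closure of that set inside \<open>W\<close>.\<close>

lemma maximum_modulus_limsup:
  assumes hol: "F holomorphic_on W" and "open W" "bounded W"
    and bd: "\<And>\<xi> e. \<xi> \<in> frontier W \<Longrightarrow> e > 0 \<Longrightarrow> \<forall>\<^sub>F z in at \<xi> within W. norm (F z) < B + e"
    and "z \<in> W"
  shows "norm (F z) \<le> B"
proof (rule ccontr)
  assume "\<not> norm (F z) \<le> B"
  then obtain e where e: "e > 0" "norm (F z) > B + e"
    by (metis add.commute field_le_epsilon less_eq_real_def not_le)
  define S where "S = {z \<in> W. norm (F z) > B + e}"
  have cont: "continuous_on W (\<lambda>z. norm (F z))"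
    using hol holomorphic_on_imp_continuous_on continuous_on_norm by blast
  have opS: "open S"
    unfolding S_def using continuous_open_preimage[OF cont \<open>open W\<close>, of "{B + e<..}"]
    by (simp add: vimage_def Int_def)
  have clW: "closure S \<subseteq> W"
  proof
    fix \<xi> assume \<xi>: "\<xi> \<in> closure S"
    show "\<xi> \<in> W"
    proof (rule ccontr)
      assume nW: "\<xi> \<notin> W"
      have "\<xi> \<in> closure W" using \<xi> closure_mono[of S W] by (auto simp: S_def)
      then have "\<xi> \<in> frontier W" using nW \<open>open W\<close> by (simp add: frontier_def interior_open)
      from bd[OF this e(1)] obtain T where T: "open T" "\<xi> \<in> T"
        "\<And>z. z \<in> T \<Longrightarrow> z \<noteq> \<xi> \<Longrightarrow> z \<in> W \<Longrightarrow> norm (F z) < B + e"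
        by (auto simp: eventually_at_topological)
      then obtain y where "y \<in> T" "y \<in> S" using \<xi>
        by (meson closure_iff_nhds_not_empty disjoint_iff subset_refl)
      then show False using T(3)[of y] nW by (auto simp: S_def)
    qed
  qed
  have "norm (F z) \<le> B + e"
  proof (rule maximum_modulus_frontier[of F S])
    show "F holomorphic_on interior S"
      using hol by (rule holomorphic_on_subset) (use interior_subset in \<open>auto simp: S_def\<close>)
    show "continuous_on (closure S) F"
      using hol clW holomorphic_on_imp_continuous_on continuous_on_subset by blast
    show "bounded S" using \<open>bounded W\<close> by (rule bounded_subset) (auto simp: S_def)
    show "norm (F \<xi>) \<le> B + e" if "\<xi> \<in> frontier S" for \<xi>
    proof -
      have "\<xi> \<in> closure S" "\<xi> \<notin> S" using that opS by (auto simp: frontier_def interior_open)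
      then show ?thesis using clW by (force simp: S_def)
    qed
    show "z \<in> S" using e \<open>z \<in> W\<close> by (simp add: S_def)
  qed
  with e show False by simp
qed

section \<open>Pseudohyperbolic distance\<close>

lemma Moebius_function_norm_commute:
  "norm (Moebius_function 0 w z) = norm (Moebius_function 0 z w)"
proof -
  have "norm (1 - cnj w * z) = norm (cnj (1 - cnj w * z))" by (simp only: complex_mod_cnj)
  then show ?thesis
    by (simp add: Moebius_function_simple norm_divide norm_minus_commute mult.commute)
qed

text \<open>This is the Schwarz lemma for the inverse Riemann map \<open>\<psi>\<close>, recentred so that \<open>0\<close> goes to \<open>v\<close>.
  It says that points of a bounded domain which are far apart in the Euclidean sense stay apart in
  the pseudohyperbolic sense; in other words, it bounds the Green function away from its pole.\<close>

lemma dist_le_pseudohyperbolic: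
  assumes holp: "\<psi> holomorphic_on ball 0 1"
    and inv: "\<And>u. u \<in> \<Omega> \<Longrightarrow> \<phi> u \<in> ball 0 1 \<and> \<psi> (\<phi> u) = u"
    and \<psi>: "\<psi> ` ball 0 1 \<subseteq> \<Omega>"
    and L: "\<And>u w. u \<in> \<Omega> \<Longrightarrow> w \<in> \<Omega> \<Longrightarrow> dist u w < L"
    and "u \<in> \<Omega>" "v \<in> \<Omega>"
  shows "dist u v \<le> L * norm (Moebius_function 0 (\<phi> v) (\<phi> u))"
proof -
  have L0: "L > 0" using L[OF \<open>u \<in> \<Omega>\<close> \<open>u \<in> \<Omega>\<close>] by simp
  let ?m = "Moebius_function 0 (\<phi> v)" and ?m' = "Moebius_function 0 (- \<phi> v)"
  have n: "norm (\<phi> v) < 1" "norm (\<phi> u) < 1" using inv assms by auto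
  define g where "g q = (\<psi> (?m' q) - v) / of_real L" for q
  have m': "?m' q \<in> ball 0 1" if "q \<in> ball 0 1" for q
    using Moebius_function_norm_lt_1[of "- \<phi> v" q] n that by simp
  have "(\<psi> \<circ> ?m') holomorphic_on ball 0 1"
    by (rule holomorphic_on_compose_gen[OF Moebius_function_holomorphic holp])
      (use n m' in auto)
  then have "g holomorphic_on ball 0 1"
    unfolding g_def o_def using L0 by (intro holomorphic_intros) auto
  moreover have "g 0 = 0"
    using inv assms by (simp add: g_def Moebius_function_of_zero)
  moreover have "norm (g q) < 1" if "norm q < 1" for q
  proof -
    have "\<psi> (?m' q) \<in> \<Omega>" using m'[of q] that \<psi> by auto
    then show ?thesis using L[of _ v] \<open>v \<in> \<Omega>\<close> L0
      by (simp add: g_def norm_divide dist_norm)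
  qed
  moreover have "norm (?m (\<phi> u)) < 1" using n by (simp add: Moebius_function_norm_lt_1)
  ultimately have "norm (g (?m (\<phi> u))) \<le> norm (?m (\<phi> u))" by (rule Schwarz_Lemma(1))
  moreover have "?m' (?m (\<phi> u)) = \<phi> u"
    using n by (intro Moebius_function_compose) auto
  ultimately show ?thesis
    using inv[OF \<open>u \<in> \<Omega>\<close>] L0 by (simp add: g_def norm_divide dist_norm field_simps)
qed

section \<open>The complement of a starlike obstacle\<close>

text \<open>The image of the complement of \<open>K\<close> in the Riemann sphere under \<open>z \<mapsto> 1 / (z - b)\<close>; the point \<open>0\<close> is
  the image of infinity.\<close>

definition inverted_complement :: "complex set \<Rightarrow> complex \<Rightarrow> complex set" where
  "inverted_complement K b = {v. v \<noteq> 0 \<longrightarrow> b + inverse v \<notin> K}"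

text \<open>Inversion exchanges the two ends of the rays from \<open>b\<close>, so a set starlike about \<open>b\<close> has a complement
  that becomes starlike about \<open>0\<close>. This makes the complement simply connected by inspection,
  and the Riemann mapping theorem applies to it.\<close>

lemma inverted_complement:
  assumes K: "compact K" and b: "b \<in> interior K"
    and star: "\<And>z. z \<in> K \<Longrightarrow> closed_segment b z \<subseteq> K"
  shows "open (inverted_complement K b)" "bounded (inverted_complement K b)"
    and "simply_connected (inverted_complement K b)"
proof -
  let ?O = "inverted_complement K b"
  obtain e where e: "e > 0" "ball b e \<subseteq> K" using b by (meson mem_interior)
  have "norm v \<le> inverse e" if "v \<in> ?O" for v
  proof (cases "v = 0")
    case False
    then have "b + inverse v \<notin> ball b e" using that e by (auto simp: inverted_complement_def)
    then have "e \<le> inverse (norm v)" by (simp add: dist_norm norm_inverse)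
    then show ?thesis
      using e(1) by (metis inverse_inverse_eq le_imp_inverse_le)
  qed (use e in simp)
  then show "bounded ?O" by (auto simp: bounded_iff)
  obtain L where L: "L > 0" "\<And>z. z \<in> K \<Longrightarrow> norm (z - b) < L"
    using bounded_subset_ballD[OF compact_imp_bounded[OF K], of b]
    by (metis dist_norm mem_ball norm_minus_commute subsetD)
  have 1: "ball 0 (inverse L) \<subseteq> ?O"
  proof
    fix v :: complex assume v: "v \<in> ball 0 (inverse L)"
    show "v \<in> ?O"
    proof (cases "v = 0")
      case False
      then have "norm (b + inverse v - b) > L"
        using v L(1) by (simp add: norm_inverse) (metis inverse_inverse_eq inverse_less_imp_less
            inverse_less_iff_less norm_eq_zero positive_imp_inverse_positive zero_less_norm_iff)
      then show ?thesis using L(2)[of "b + inverse v"] by (auto simp: inverted_complement_def)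
    qed (simp add: inverted_complement_def)
  qed
  have "open {v \<in> - {0}. b + inverse v \<in> - K}"
  proof -
    have "continuous_on (- {0}) (\<lambda>v. b + inverse v)" by (intro continuous_intros) auto
    from continuous_open_preimage[OF this, of "- K"] show ?thesis
      using K by (simp add: vimage_def Int_def compact_imp_closed open_Compl)
  qed
  moreover have "?O = {v \<in> - {0}. b + inverse v \<in> - K} \<union> ball 0 (inverse L)"
    using 1 L(1) by (auto simp: inverted_complement_def)
  ultimately show "open ?O" by auto
  have "starlike ?O"
    unfolding starlike_def
  proof (intro bexI[of _ 0] ballI subsetI)
    show "0 \<in> ?O" by (simp add: inverted_complement_def)
    fix v w assume v: "v \<in> ?O" and "w \<in> closed_segment 0 v"
    then obtain t where t: "0 \<le> t" "t \<le> 1" "w = t *\<^sub>R v" by (auto simp: in_segment)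
    show "w \<in> ?O"
      unfolding inverted_complement_def
    proof (clarify)
      assume "w \<noteq> 0" and "b + inverse w \<in> K"
      then have "closed_segment b (b + inverse w) \<subseteq> K" using star by blast
      moreover have "b + inverse v = (1 - t) *\<^sub>R b + t *\<^sub>R (b + inverse w)"
        using \<open>w \<noteq> 0\<close> t by (simp add: algebra_simps scaleR_conv_of_real)
      then have "b + inverse v \<in> closed_segment b (b + inverse w)"
        unfolding in_segment using t by blast
      ultimately have "b + inverse v \<in> K" by blast
      with v show False using \<open>w \<noteq> 0\<close> t by (simp add: inverted_complement_def)
    qed
  qed
  then show "simply_connected ?O" by (rule starlike_imp_simply_connected)
qed


section \<open>Barriers bound the squeezing function from below\<close>

text \<open>Here \<open>Re H\<close> is a nonnegative harmonic function near \<open>\<zeta>\<close> that is at least \<open>c\<close> on the circle of radius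
  \<open>r\<close>. The disc of holomorphy is larger than that circle so that \<open>H\<close> is continuous at the points of
  the circle lying in \<open>D\<close>.\<close>

definition barrier_at :: "complex set \<Rightarrow> complex \<Rightarrow> real \<Rightarrow> real \<Rightarrow> (complex \<Rightarrow> complex) \<Rightarrow> bool" where
  "barrier_at D \<zeta> r c H \<longleftrightarrow>
     (\<exists>r'>r. H holomorphic_on D \<inter> ball \<zeta> r' \<and> (\<forall>u\<in>D \<inter> ball \<zeta> r'. 0 \<le> Re (H u))) \<and>
     (\<forall>u\<in>D \<inter> sphere \<zeta> r. c \<le> Re (H u))"

text \<open>Let \<open>\<phi>\<close> be the Riemann map of the inverted complement \<open>\<Omega>\<close> of the obstacle \<open>cball a R - D\<close> and
  \<open>T u = 1 / (u - b)\<close>. For \<open>z\<close> in \<open>D\<close> follow \<open>\<phi> \<circ> T\<close> by the disc automorphism that sends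
  \<open>\<phi> (T z)\<close> to \<open>0\<close>. The values of the disc missed by this embedding of \<open>D\<close> come from points \<open>v\<close> of \<open>\<Omega>\<close> outside
  \<open>T ` D\<close>, hence from points of the sphere outside \<open>cball a R\<close>. Their modulus is the
  pseudohyperbolic distance of \<open>\<phi> v\<close> and \<open>\<phi> (T z)\<close>, which is symmetric, so \<open>v\<close> may be fixed and \<open>z\<close>
  varied: \<open>exp (- (M / c) * H)\<close> divided by the Moebius expression \<open>m v\<close> has modulus at most \<open>1\<close> on the
  boundary of \<open>D \<inter> ball \<zeta> r\<close>. On the circle this is the Schwarz lemma together with \<open>Re H \<ge> c\<close>; at the
  boundary of \<open>D\<close> it holds because \<open>|\<phi>|\<close> tends to \<open>1\<close> there. The constant \<open>M\<close> does
  not depend on \<open>v\<close>, \<open>\<zeta>\<close> or \<open>r\<close>.\<close>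

theorem squeezing_function_barrier_bound:
  fixes D :: "complex set"
  assumes opD: "open D" and R: "R > 0"
    and b: "b \<in> interior (cball a R - D)"
    and star: "\<And>z. z \<in> cball a R - D \<Longrightarrow> closed_segment b z \<subseteq> cball a R - D"
  obtains M where "M > 0"
    and "\<And>\<zeta> r c H z. \<lbrakk>barrier_at D \<zeta> r c H; \<zeta> \<in> ball a (R/4); 0 < r; r \<le> R/4; 0 < c;
        z \<in> D \<inter> ball \<zeta> r\<rbrakk> \<Longrightarrow> exp (- (M / c) * Re (H z)) \<le> squeezing_function D z"
proof -
  define K where "K = cball a R - D"
  have K: "compact K" unfolding K_def using opD by (simp add: compact_diff)
  define \<Omega> where "\<Omega> = inverted_complement K b"
  note \<Omega> = inverted_complement[OF K b[folded K_def] star[folded K_def], folded \<Omega>_def]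
  have "0 \<in> \<Omega>" by (simp add: \<Omega>_def inverted_complement_def)
  then have "\<Omega> \<noteq> {}" by auto
  moreover have "\<Omega> \<noteq> UNIV" using \<Omega>(2) not_bounded_UNIV by auto
  ultimately obtain \<phi> \<psi> where holf: "\<phi> holomorphic_on \<Omega>" and holp: "\<psi> holomorphic_on ball 0 1"
    and \<phi>: "\<And>u. u \<in> \<Omega> \<Longrightarrow> \<phi> u \<in> ball 0 1 \<and> \<psi> (\<phi> u) = u"
    and \<psi>: "\<And>q. q \<in> ball 0 1 \<Longrightarrow> \<psi> q \<in> \<Omega> \<and> \<phi> (\<psi> q) = q"
    using Riemann_mapping_theorem[of \<Omega>] \<Omega>(1,3) by metis
  obtain L0 where L0: "L0 > 0" "\<And>u. u \<in> \<Omega> \<Longrightarrow> norm u < L0"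
    using bounded_pos_less[of \<Omega>] \<Omega>(2) by auto
  \<comment> \<open>The summand \<open>inverse R\<close> only ensures that the logarithm \<open>M\<close> below is positive.\<close>
  define L where "L = 2 * L0 + inverse R"
  have "L > 0" using L0(1) R by (simp add: L_def add_pos_pos)
  moreover have "L * R = 2 * L0 * R + 1" using R by (simp add: L_def field_simps)
  ultimately have Lpos: "L > 0" "L * R \<ge> 1" using L0(1) R by simp_all
  have L: "dist u w < L" if "u \<in> \<Omega>" "w \<in> \<Omega>" for u w
  proof -
    have "dist u w \<le> norm u + norm w" by (simp add: dist_norm norm_triangle_ineq4)
    also have "\<dots> < L"
      unfolding L_def using L0(2)[OF that(1)] L0(2)[OF that(2)] positive_imp_inverse_positive[OF R]
      by linarith
    finally show ?thesis .
  qed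
  have bK: "b \<in> K" using b interior_subset unfolding K_def by blast
  have baR: "dist b a \<le> R" using bK by (simp add: K_def dist_commute)
  define T where "T u = inverse (u - b)" for u
  have TD: "T u \<in> \<Omega>" "u \<noteq> b" if "u \<in> D" for u
    using that bK by (auto simp: \<Omega>_def inverted_complement_def T_def K_def)
  have injT: "inj_on T D" by (auto simp: inj_on_def T_def)
  have holT: "T holomorphic_on D"
    unfolding T_def using TD(2) by (intro holomorphic_intros) auto
  define m where "m v u = Moebius_function 0 (\<phi> v) (\<phi> (T u))" for v u
  have phn: "norm (\<phi> v) < 1" if "v \<in> \<Omega>" for v using \<phi>[OF that] by simp
  have mhol: "m v holomorphic_on D" if "v \<in> \<Omega>" for v
  proof -
    have "(\<phi> \<circ> T) holomorphic_on D"
      using holT holf by (rule holomorphic_on_compose_gen) (use TD in auto)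
    from holomorphic_on_compose_gen[OF this Moebius_function_holomorphic[of "\<phi> v"]]
    show ?thesis unfolding m_def o_def using phn[OF that] \<phi> TD(1) by fastforce
  qed
  have minv: "Moebius_function 0 (- \<phi> v) (m v u) = \<phi> (T u)" if "v \<in> \<Omega>" "u \<in> D" for v u
    unfolding m_def using phn that TD by (intro Moebius_function_compose) auto
  have mlt: "norm (m v u) < 1" if "v \<in> \<Omega>" "u \<in> D" for v u
    unfolding m_def using phn that TD by (intro Moebius_function_norm_lt_1) auto
  define M where "M = ln (L * (10 * R))"
  have LR: "L * (10 * R) > 1" using Lpos by (simp add: mult.commute mult.left_commute)
  have "M > 0" unfolding M_def using LR by (rule ln_gt_zero)
  show thesis
  proof (rule that[OF \<open>M > 0\<close>])
    fix \<zeta> r c H z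
    assume "barrier_at D \<zeta> r c H" and \<zeta>: "\<zeta> \<in> ball a (R/4)" and r0: "0 < r" "r \<le> R/4"
      and c: "0 < c" and z: "z \<in> D \<inter> ball \<zeta> r"
    then obtain r' where r': "r < r'" and holH: "H holomorphic_on D \<inter> ball \<zeta> r'"
      and H0: "\<And>u. u \<in> D \<inter> ball \<zeta> r' \<Longrightarrow> 0 \<le> Re (H u)"
      and Hc: "\<And>u. u \<in> D \<inter> sphere \<zeta> r \<Longrightarrow> c \<le> Re (H u)"
      unfolding barrier_at_def by blast
    note r = r0 r'
    let ?C = "M / c"
    \<comment> \<open>A missed \<open>v\<close> corresponds to infinity or to a point at distance more than \<open>R\<close> from \<open>a\<close>.\<close>
    have far: "inverse (10 * R) \<le> L * norm (m v u)"
      if v: "v \<in> \<Omega>" "v \<notin> T ` D" and u: "u \<in> D" "dist u a \<le> R/2" for u v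
    proof -
      have ub: "dist u b \<le> 2 * R" "u \<noteq> b"
        using u baR dist_triangle[of u b a] TD(2) R by (auto simp: dist_commute)
      have "inverse (10 * R) \<le> dist (T u) v"
      proof (cases "v = 0")
        case True
        have "inverse (10 * R) \<le> inverse (dist u b)"
          using ub R by (intro le_imp_inverse_le) auto
        then show ?thesis using True by (simp add: T_def norm_inverse dist_norm)
      next
        case False
        define w where "w = b + inverse v"
        have vw: "v = T w" "w \<noteq> b" using False by (auto simp: w_def T_def)
        have "w \<notin> K" using v False by (simp add: \<Omega>_def inverted_complement_def w_def)
        moreover have "w \<notin> D" using v vw by blast
        ultimately have wa: "dist w a > R" by (simp add: K_def dist_commute)
        have uw: "dist u w \<ge> R/2" using wa u(2) dist_triangle[of w a u] by (simp add: dist_commute)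
        have "dist w b \<le> dist u w + dist u b"
          by (metis dist_commute dist_triangle)
        also have "\<dots> \<le> 5 * dist u w" using uw ub by simp
        finally have wb: "dist w b \<le> 5 * dist u w" .
        have "T u - T w = (w - u) / ((u - b) * (w - b))"
          using ub vw by (simp add: T_def field_simps)
        then have "dist (T u) v = dist u w / (dist u b * dist w b)"
          unfolding vw(1) dist_norm by (simp add: norm_divide norm_mult norm_minus_commute)
        moreover have "dist u b * dist w b \<le> (2 * R) * (5 * dist u w)"
          using ub wb R by (intro mult_mono) auto
        moreover have "0 < dist u b * dist w b" using ub vw by simp
        ultimately have "dist u w / ((2 * R) * (5 * dist u w)) \<le> dist (T u) v"
          using divide_left_mono[of "dist u b * dist w b" "(2 * R) * (5 * dist u w)" "dist u w"]
          by (metis zero_le_dist less_le_trans mult_pos_pos)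
        moreover have "dist u w / ((2 * R) * (5 * dist u w)) = inverse (10 * R)"
          using R uw by (auto simp: field_simps)
        ultimately show ?thesis by simp
      qed
      also have "\<dots> \<le> L * norm (m v u)"
        unfolding m_def using \<phi> \<psi> TD(1) u v L by (intro dist_le_pseudohyperbolic[OF holp]) auto
      finally show ?thesis .
    qed
    define W where "W = D \<inter> ball \<zeta> r"
    have Ra: "dist u a \<le> R/2" if "dist u \<zeta> \<le> R/4" for u
      using that \<zeta> dist_triangle[of u a \<zeta>] by (simp add: dist_commute)
    have missed: "exp (- ?C * Re (H u)) \<le> norm (m v u)"
      if v: "v \<in> \<Omega>" "v \<notin> T ` D" and u: "u \<in> W" for u v
    proof -
      define F where "F u = exp (- of_real ?C * H u) / m v u" for u
      have nz: "m v u \<noteq> 0" if "u \<in> D" for u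
      proof
        assume "m v u = 0"
        then have "\<phi> v = \<phi> (T u)"
          using minv[OF v(1) that] by (simp add: Moebius_function_of_zero)
        then have "v = T u" using \<phi> v(1) TD(1)[OF that] by metis
        with v(2) that show False by blast
      qed
      have holF: "F holomorphic_on D \<inter> ball \<zeta> r'"
        unfolding F_def using nz mhol[OF v(1)]
        by (intro holomorphic_intros holH) (auto intro: holomorphic_on_subset)
      have nF: "norm (F u) = exp (- ?C * Re (H u)) / norm (m v u)" for u
        by (simp add: F_def norm_divide)
      have "norm (F u) \<le> 1"
      proof (rule maximum_modulus_limsup[OF _ _ _ _ u])
        show "F holomorphic_on W"
          using holF by (rule holomorphic_on_subset) (use r in \<open>auto simp: W_def\<close>)
        show "open W" "bounded W" using opD by (auto simp: W_def bounded_Int)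
        fix \<xi> e assume \<xi>: "\<xi> \<in> frontier W" and e: "(0::real) < e"
        have "\<xi> \<in> closure W" "\<xi> \<notin> W"
          using \<xi> \<open>open W\<close> by (auto simp: frontier_def interior_open)
        moreover have "closure W \<subseteq> cball \<zeta> r"
          by (rule closure_minimal) (auto simp: W_def)
        ultimately have \<xi>r: "dist \<zeta> \<xi> \<le> r" by auto
        show "\<forall>\<^sub>F w in at \<xi> within W. norm (F w) < 1 + e"
        proof (cases "\<xi> \<in> D")
          case True
          then have sph: "dist \<zeta> \<xi> = r" using \<xi>r \<open>\<xi> \<notin> W\<close> by (auto simp: W_def)
          have "inverse (10 * R) \<le> L * norm (m v \<xi>)"
            using far[OF v True] Ra[of \<xi>] sph r by (simp add: dist_commute)
          then have "inverse (L * (10 * R)) \<le> norm (m v \<xi>)"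
            using Lpos R by (simp add: field_simps)
          also have "inverse (L * (10 * R)) = exp (- M)"
            using LR by (simp add: M_def exp_minus)
          finally have 1: "exp (- M) \<le> norm (m v \<xi>)" .
          have "M \<le> ?C * Re (H \<xi>)"
            using Hc[of \<xi>] True sph c \<open>M > 0\<close> by (simp add: field_simps)
          then have "exp (- ?C * Re (H \<xi>)) \<le> exp (- M)" by simp
          then have "exp (- ?C * Re (H \<xi>)) \<le> norm (m v \<xi>)" using 1 by (rule order_trans)
          then have "norm (F \<xi>) \<le> 1"
            unfolding nF using nz[OF True] by (simp only: divide_le_eq_1 zero_less_norm_iff simp_thms)
          moreover have "((\<lambda>w. norm (F w)) \<longlongrightarrow> norm (F \<xi>)) (at \<xi>)"
          proof -
            have "open (D \<inter> ball \<zeta> r')" "\<xi> \<in> D \<inter> ball \<zeta> r'"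
              using opD True sph r by auto
            then have "isCont F \<xi>"
              using holF holomorphic_on_imp_continuous_on continuous_on_eq_continuous_at by blast
            then show ?thesis by (intro tendsto_norm) (simp add: isCont_def)
          qed
          ultimately have "\<forall>\<^sub>F w in at \<xi>. norm (F w) < 1 + e"
            using e by (intro order_tendstoD) auto
          then show ?thesis
            by (rule filter_leD[OF at_le[OF subset_UNIV]])
        next
          case False
          then have \<xi>K: "\<xi> \<in> K" using Ra[of \<xi>] \<xi>r r R by (simp add: K_def dist_commute)
          have "\<xi> \<noteq> b"
          proof
            assume "\<xi> = b"
            then have "\<xi> \<in> interior K" using b by (simp add: K_def)
            moreover have "interior K \<inter> W = {}"
              using interior_subset[of K] by (auto simp: K_def W_def)
            ultimately show False using \<open>\<xi> \<in> closure W\<close>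
              by (metis Int_commute disjoint_iff open_Int_closure_eq_empty open_interior)
          qed
          \<comment> \<open>Compact subsets of the disc pull back to compact subsets of \<open>\<Omega>\<close>, which \<open>T w\<close> leaves.\<close>
          define \<eta> where "\<eta> = inverse (1 + e)"
          have \<eta>: "0 < \<eta>" "\<eta> < 1" using e by (auto simp: \<eta>_def field_simps)
          define Q where "Q = (\<psi> \<circ> Moebius_function 0 (- \<phi> v)) ` cball 0 \<eta>"
          have sub: "Moebius_function 0 (- \<phi> v) ` cball 0 \<eta> \<subseteq> ball 0 1"
            using Moebius_function_norm_lt_1[of "- \<phi> v"] phn[OF v(1)] \<eta> by auto
          have "compact Q"
            unfolding Q_def
          proof (rule compact_continuous_image[OF _ compact_cball], rule continuous_on_compose)
            show "continuous_on (cball 0 \<eta>) (Moebius_function 0 (- \<phi> v))"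
              using Moebius_function_holomorphic[of "- \<phi> v" 0] phn[OF v(1)] \<eta>
              by (intro continuous_on_subset[OF holomorphic_on_imp_continuous_on]) auto
            show "continuous_on (Moebius_function 0 (- \<phi> v) ` cball 0 \<eta>) \<psi>"
              using holp sub by (intro continuous_on_subset[OF holomorphic_on_imp_continuous_on])
          qed
          then have "open (- Q)" by (simp add: compact_imp_closed open_Compl)
          moreover have "T \<xi> \<notin> Q"
          proof
            assume "T \<xi> \<in> Q"
            then have "T \<xi> \<in> \<Omega>" unfolding Q_def using sub \<psi> by auto
            with \<xi>K \<open>\<xi> \<noteq> b\<close> show False by (simp add: \<Omega>_def inverted_complement_def T_def)
          qed
          moreover have "(T \<longlongrightarrow> T \<xi>) (at \<xi> within W)"
            unfolding T_def using \<open>\<xi> \<noteq> b\<close> by (intro tendsto_intros) auto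
          ultimately have "\<forall>\<^sub>F w in at \<xi> within W. T w \<in> - Q"
            by (intro topological_tendstoD) auto
          moreover have "\<forall>\<^sub>F w in at \<xi> within W. w \<in> W"
            by (auto simp: eventually_at_filter)
          ultimately show ?thesis
          proof eventually_elim
            case (elim w)
            then have w: "w \<in> D" "w \<in> D \<inter> ball \<zeta> r'" using r by (auto simp: W_def)
            have "norm (m v w) > \<eta>"
            proof (rule ccontr)
              assume "\<not> norm (m v w) > \<eta>"
              then have "(\<psi> \<circ> Moebius_function 0 (- \<phi> v)) (m v w) \<in> Q"
                unfolding Q_def by (intro imageI) simp
              moreover have "(\<psi> \<circ> Moebius_function 0 (- \<phi> v)) (m v w) = T w"
                using minv[OF v(1) w(1)] \<phi> TD(1)[OF w(1)] by simp
              ultimately show False using elim by simp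
            qed
            moreover have "exp (- ?C * Re (H w)) \<le> 1"
              using H0[OF w(2)] c \<open>M > 0\<close> by simp
            ultimately have "norm (F w) < 1 / \<eta>"
              unfolding nF using \<eta> by (intro frac_less2) auto
            then show ?case by (simp add: \<eta>_def field_simps)
          qed
        qed
      qed
      then show ?thesis unfolding nF using nz[of u] u by (simp add: W_def divide_le_eq)
    qed
    have zD: "z \<in> D" "z \<in> W" using z by (auto simp: W_def)
    let ?f = "m (T z)"
    have Tz: "T z \<in> \<Omega>" using TD zD by blast
    show "exp (- ?C * Re (H z)) \<le> squeezing_function D z"
    proof (rule squeezing_function_ge[OF opD zD(1)])
      have "inj_on ?f D"
      proof (rule inj_onI)
        fix x y assume xy: "x \<in> D" "y \<in> D" "?f x = ?f y"
        then have "\<phi> (T x) = \<phi> (T y)" using minv[OF Tz] by metis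
        then have "T x = T y" using \<phi> TD(1) xy by metis
        then show "x = y" using injT xy by (auto dest: inj_onD)
      qed
      then have "holomorphic_embedding ?f D (ball 0 1)"
        using mhol[OF Tz] mlt[OF Tz] by (intro injective_holomorphic_embedding[OF opD]) auto
      moreover have "?f z = 0" by (simp add: m_def Moebius_function_eq_zero)
      ultimately show "?f \<in> squeezing_embeddings D z" by (simp add: squeezing_embeddings_def)
      show "ball 0 (exp (- ?C * Re (H z))) \<subseteq> ?f ` D"
      proof
        fix q assume q: "q \<in> ball (0::complex) (exp (- ?C * Re (H z)))"
        have "exp (- ?C * Re (H z)) \<le> 1"
          using H0[of z] z r c \<open>M > 0\<close> by simp
        moreover have "norm q < exp (- ?C * Re (H z))" using q by (simp only: mem_ball_0)
        ultimately have q1: "norm q < 1" by linarith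
        let ?q = "Moebius_function 0 (- \<phi> (T z)) q"
        have q2: "norm ?q < 1"
          using q1 phn[OF Tz] by (intro Moebius_function_norm_lt_1) auto
        have q3: "Moebius_function 0 (\<phi> (T z)) ?q = q"
          using q1 phn[OF Tz] by (intro Moebius_function_compose) auto
        define v where "v = \<psi> ?q"
        have v: "v \<in> \<Omega>" "\<phi> v = ?q" using \<psi>[of ?q] q2 by (auto simp: v_def)
        show "q \<in> ?f ` D"
        proof (cases "v \<in> T ` D")
          case True
          then obtain u where "u \<in> D" "v = T u" by blast
          then show ?thesis using q3 v(2) by (intro image_eqI[of _ _ u]) (simp_all add: m_def)
        next
          case False
          have "norm (m v z) = norm q"
            unfolding m_def v(2) by (subst Moebius_function_norm_commute) (simp add: q3)
          then show ?thesis using missed[OF v(1) False zD(2)] q by simp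
        qed
      qed
    qed simp
  qed
qed

section \<open>Local geometry of smooth boundary points\<close>

text \<open>Transfers boundary points of \<open>D\<close> to the smooth local piece \<open>D \<inter> U\<close>.\<close>

lemma frontier_Int_open:
  assumes "open D" "open U" "q \<in> U" "q \<in> frontier D"
  shows "q \<in> frontier (D \<inter> U)"
proof -
  have "q \<in> U \<inter> closure D" "q \<notin> D"
    using assms by (auto simp: frontier_def interior_open)
  then have "q \<in> closure (U \<inter> D)" using open_Int_closure_subset[OF \<open>open U\<close>] by blast
  with \<open>q \<notin> D\<close> show ?thesis using assms(1,2)
    by (auto simp: frontier_def interior_open open_Int Int_commute)
qed

lemma near_linear_on_convex:
  assumes "convex S" "\<And>z. z \<in> S \<Longrightarrow> GDERIV \<rho> z :> g z"
    and e: "\<And>z. z \<in> S \<Longrightarrow> norm (g z - d) \<le> e" and pq: "p \<in> S" "q \<in> S"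
  shows "\<bar>\<rho> p - \<rho> q - (p - q) \<bullet> d\<bar> \<le> e * norm (p - q)"
proof -
  have "norm ((\<rho> p - p \<bullet> d) - (\<rho> q - q \<bullet> d)) \<le> e * norm (p - q)"
  proof (rule differentiable_bound[OF \<open>convex S\<close>, of _ "\<lambda>z h. h \<bullet> (g z - d)"])
    fix z assume z: "z \<in> S"
    have "(\<rho> has_derivative (\<lambda>h. h \<bullet> g z)) (at z within S)"
      using assms(2)[OF z] unfolding gderiv_def by (rule has_derivative_at_withinI)
    then have "((\<lambda>z. \<rho> z - z \<bullet> d) has_derivative (\<lambda>h. h \<bullet> g z - h \<bullet> d)) (at z within S)"
      by (auto intro!: derivative_eq_intros)
    then show "((\<lambda>z. \<rho> z - z \<bullet> d) has_derivative (\<lambda>h. h \<bullet> (g z - d))) (at z within S)"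
      by (simp add: inner_diff_right)
    show "onorm (\<lambda>h. h \<bullet> (g z - d)) \<le> e"
    proof (rule onorm_bound)
      show "0 \<le> e" using e[OF z] by (meson norm_ge_zero order_trans)
      fix h
      have "norm (h \<bullet> (g z - d)) \<le> norm h * norm (g z - d)" by (simp add: Cauchy_Schwarz_ineq2)
      also have "\<dots> \<le> norm h * e" using e[OF z] by (intro mult_left_mono) auto
      finally show "norm (h \<bullet> (g z - d)) \<le> e * norm h" by (simp add: mult.commute)
    qed
  qed (use pq in auto)
  then show ?thesis by (simp add: inner_diff_left algebra_simps)
qed

text \<open>Where the gradient of \<open>\<rho>\<close> is nearly constant, the part of a small disc outside \<open>D\<close> is nearly a half
  disc, with \<open>b\<close> deep inside. Along a segment from \<open>b\<close> to \<open>z\<close> there are two cases. If the segment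
  runs clearly against the gradient, then \<open>\<rho>\<close> decreases along it and stays above \<open>\<rho> z\<close>; otherwise \<open>\<rho>\<close>
  drops by too little to use up the positive value \<open>\<rho> b\<close>.\<close>

lemma starlike_obstacle:
  assumes G: "C1_defining_function (D \<inter> U) V \<rho> g" and "open D" "open U"
    and a: "a \<in> frontier D" and R: "R > 0" "cball a R \<subseteq> U \<inter> V"
    and osc: "\<And>z. z \<in> cball a R \<Longrightarrow> norm (g z - g a) \<le> norm (g a) / 16"
  obtains b where "b \<in> interior (cball a R - D)"
    and "\<And>z. z \<in> cball a R - D \<Longrightarrow> closed_segment b z \<subseteq> cball a R - D"
proof -
  let ?K = "cball a R - D"
  have aR: "a \<in> U" "a \<in> V" using R by auto
  have ga: "norm (g a) > 0" using G aR by (auto simp: C1_defining_function_def)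
  have "z \<in> D \<longleftrightarrow> \<rho> z < 0" if "z \<in> cball a R" for z
    using G R(2) that unfolding C1_defining_function_def by blast
  then have K: "?K = {z \<in> cball a R. 0 \<le> \<rho> z}" by (auto simp: not_less)
  have \<rho>a: "\<rho> a = 0"
    using assms(2,3) aR a
    by (intro C1_defining_function_zero[OF G] frontier_Int_open open_Int)
  define e where "e = norm (g a) / 16"
  have e: "e > 0" "norm (g a) = 16 * e" using ga by (simp_all add: e_def)
  define s where "s = R / 2"
  have s: "s > 0" "R = 2 * s" using R by (simp_all add: s_def)
  define b where "b = a + s *\<^sub>R sgn (g a)"
  have ng: "norm (sgn (g a)) = 1" "sgn (g a) \<bullet> g a = norm (g a)"
    using ga by (auto simp: norm_sgn sgn_div_norm dot_square_norm power2_eq_square)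
  have lin: "\<rho> q + (p - q) \<bullet> g a - e * norm (p - q) \<le> \<rho> p"
    if "p \<in> cball a R" "q \<in> cball a R" for p q
  proof -
    have "\<bar>\<rho> p - \<rho> q - (p - q) \<bullet> g a\<bar> \<le> e * norm (p - q)"
      using osc G R that unfolding e_def
      by (intro near_linear_on_convex[of "cball a R" \<rho> g]) (auto simp: C1_defining_function_def)
    then show ?thesis by (simp add: abs_le_iff)
  qed
  have bd: "dist a b = s" using s ng by (simp add: b_def dist_norm)
  then have bR: "b \<in> ball a R" "b \<in> cball a R" using s by auto
  have ba: "(b - a) \<bullet> g a = s * (16 * e)" "norm (b - a) = s"
    using ng s e by (simp_all add: b_def)
  have \<rho>b: "15 * (e * s) \<le> \<rho> b"
    using lin[OF bR(2), of a] R unfolding ba \<rho>a by (simp add: algebra_simps)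
  have \<rho>b0: "0 < \<rho> b" using \<rho>b mult_pos_pos[OF e(1) s(1)] by linarith
  show thesis
  proof
    have "continuous_on (ball a R) \<rho>"
    proof (rule continuous_at_imp_continuous_on, rule ballI)
      fix z assume "z \<in> ball a R"
      then have "z \<in> V" using R(2) by auto
      then have "GDERIV \<rho> z :> g z" using G by (simp add: C1_defining_function_def)
      then show "isCont \<rho> z" unfolding gderiv_def by (rule has_derivative_continuous)
    qed
    from continuous_open_preimage[OF this open_ball, of "{0<..}"]
    have "open {z \<in> ball a R. 0 < \<rho> z}" by (simp add: vimage_def Int_def)
    moreover have "b \<in> {z \<in> ball a R. 0 < \<rho> z}" using bR \<rho>b0 by auto
    moreover have "{z \<in> ball a R. 0 < \<rho> z} \<subseteq> ?K" unfolding K by auto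
    ultimately show "b \<in> interior ?K" by (meson interiorI)
  next
    fix z assume z: "z \<in> ?K"
    show "closed_segment b z \<subseteq> ?K"
    proof
      fix p assume p: "p \<in> closed_segment b z"
      have pR: "p \<in> cball a R"
        using p z closed_segment_subset[OF bR(2) _ convex_cball, of z] by blast
      obtain t where t: "0 \<le> t" "t \<le> 1" "p = (1 - t) *\<^sub>R b + t *\<^sub>R z"
        using p by (auto simp: in_segment)
      have pb: "p - b = t *\<^sub>R (z - b)" and pz: "p - z = (1 - t) *\<^sub>R (b - z)"
        by (simp_all add: t(3) algebra_simps)
      have "0 \<le> \<rho> p"
      proof (cases "(z - b) \<bullet> g a \<le> - (e * norm (z - b))")
        case True
        have "\<rho> z + ((p - z) \<bullet> g a - e * norm (p - z)) \<le> \<rho> p"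
          using lin[OF pR, of z] z by simp
        moreover have "norm (p - z) = (1 - t) * norm (z - b)"
          unfolding pz norm_minus_commute[of z b] using t(1,2) by simp
        moreover have "(p - z) \<bullet> g a = (1 - t) * (- ((z - b) \<bullet> g a))"
          by (simp add: pz inner_diff_left)
        ultimately have "\<rho> z + (1 - t) * (- ((z - b) \<bullet> g a) - e * norm (z - b)) \<le> \<rho> p"
          by (simp add: right_diff_distrib mult.left_commute)
        moreover have "0 \<le> (1 - t) * (- ((z - b) \<bullet> g a) - e * norm (z - b))"
          using t True by (intro mult_nonneg_nonneg) auto
        ultimately show ?thesis using z unfolding K by auto
      next
        case False
        have "dist b z \<le> dist a b + dist a z" by (metis dist_commute dist_triangle)
        then have zb: "norm (z - b) \<le> 4 * s"
          using bd z s by (auto simp: dist_norm norm_minus_commute)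
        have "\<rho> b + ((p - b) \<bullet> g a - e * norm (p - b)) \<le> \<rho> p"
          using lin[OF pR bR(2)] by simp
        moreover have "(p - b) \<bullet> g a - e * norm (p - b) = t * ((z - b) \<bullet> g a - e * norm (z - b))"
          unfolding pb using t(1,2) by (simp add: right_diff_distrib mult.left_commute)
        moreover have "t * (- (2 * (e * norm (z - b)))) \<le> t * ((z - b) \<bullet> g a - e * norm (z - b))"
          using t False by (intro mult_left_mono) auto
        moreover
        have "t * (2 * (e * norm (z - b))) \<le> 1 * (2 * (e * (4 * s)))"
          using t zb e s by (intro mult_mono) auto
        then have "t * (2 * (e * norm (z - b))) \<le> 8 * (e * s)" by simp
        moreover have "0 < e * s" using e s by simp
        ultimately show ?thesis using \<rho>b unfolding mult_minus_right by linarith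
      qed
      then show "p \<in> ?K" using pR unfolding K by simp
    qed
  qed
qed

text \<open>A version of Rolle's theorem: on the segment from \<open>\<zeta>\<close> to \<open>z\<close>, the last point \<open>q\<close> with \<open>\<rho> \<ge> 0\<close>
  is a boundary point at which \<open>\<rho>\<close> does not increase in the direction \<open>z - \<zeta>\<close>. This turns information
  on normals into information on the position of \<open>D\<close>.\<close>

lemma boundary_crossing:
  assumes G: "C1_defining_function (D \<inter> U) V \<rho> g" and opn: "open D" "open U"
    and \<zeta>: "\<zeta> \<in> frontier D" and z: "z \<in> D" and seg: "closed_segment \<zeta> z \<subseteq> U \<inter> V"
  obtains q where "q \<in> frontier D" "q \<in> closed_segment \<zeta> z" "dist q \<zeta> < dist z \<zeta>"
    and "(z - \<zeta>) \<bullet> g q \<le> 0"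
proof -
  define \<gamma> where "\<gamma> s = \<zeta> + s *\<^sub>R (z - \<zeta>)" for s :: real
  have \<gamma>seg: "\<gamma> s \<in> closed_segment \<zeta> z" if "0 \<le> s" "s \<le> 1" for s
    using that unfolding in_segment by (intro exI[of _ s]) (simp add: \<gamma>_def algebra_simps)
  have \<gamma>V: "\<gamma> s \<in> U" "\<gamma> s \<in> V" if "0 \<le> s" "s \<le> 1" for s using \<gamma>seg[OF that] seg by auto
  have memD: "\<gamma> s \<in> D \<longleftrightarrow> \<rho> (\<gamma> s) < 0" if "0 \<le> s" "s \<le> 1" for s
    using G \<gamma>V[OF that] by (auto simp: C1_defining_function_def)
  have der: "((\<lambda>s. \<rho> (\<gamma> s)) has_real_derivative (z - \<zeta>) \<bullet> g (\<gamma> s)) (at s)"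
    if "0 \<le> s" "s \<le> 1" for s
  proof -
    have "(\<gamma> has_derivative (\<lambda>t. t *\<^sub>R (z - \<zeta>))) (at s)"
      unfolding \<gamma>_def by (auto intro!: derivative_eq_intros)
    moreover have "(\<rho> has_derivative (\<lambda>h. h \<bullet> g (\<gamma> s))) (at (\<gamma> s))"
      using G \<gamma>V[OF that] by (auto simp: C1_defining_function_def gderiv_def)
    ultimately have "((\<rho> \<circ> \<gamma>) has_derivative (\<lambda>h. h \<bullet> g (\<gamma> s)) \<circ> (\<lambda>t. t *\<^sub>R (z - \<zeta>))) (at s)"
      by (rule diff_chain_at)
    then show ?thesis by (simp add: has_field_derivative_def o_def mult_commute_abs)
  qed
  have cont: "continuous_on {0..1} (\<lambda>s. \<rho> (\<gamma> s))"
    by (intro continuous_at_imp_continuous_on ballI DERIV_isCont[OF der]) auto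
  define S where "S = {s \<in> {0..1}. 0 \<le> \<rho> (\<gamma> s)}"
  have "closed S" unfolding S_def
    using continuous_closed_preimage[OF cont closed_atLeastAtMost, of "{0..}"]
    by (simp add: vimage_def Int_def)
  then have "compact S" unfolding S_def
    by (metis (no_types, lifting) compact_eq_bounded_closed bounded_subset bounded_closed_interval
        mem_Collect_eq subsetI)
  moreover have "\<zeta> \<notin> D" using \<zeta> opn by (auto simp: frontier_def interior_open)
  then have "0 \<in> S" using memD[of 0] by (auto simp: S_def \<gamma>_def)
  ultimately obtain s where s: "s \<in> S" "\<And>t. t \<in> S \<Longrightarrow> t \<le> s"
    using compact_attains_sup[of S] by blast
  have s01: "0 \<le> s" "s \<le> 1" "0 \<le> \<rho> (\<gamma> s)" using s by (auto simp: S_def)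
  have "s \<noteq> 1" using s01 memD[of 1] z by (auto simp: \<gamma>_def)
  with s01 have s1: "s < 1" by simp
  have neg: "\<rho> (\<gamma> t) < 0" if "s < t" "t \<le> 1" for t
    using s(2)[of t] that s01 by (force simp: S_def)
  let ?q = "\<gamma> s"
  show thesis
  proof
    show "?q \<in> closed_segment \<zeta> z" using s01 by (intro \<gamma>seg) auto
    have "z \<noteq> \<zeta>" using z \<open>\<zeta> \<notin> D\<close> by auto
    then show "dist ?q \<zeta> < dist z \<zeta>" using s1 s01 by (simp add: \<gamma>_def dist_norm)
    show "(z - \<zeta>) \<bullet> g ?q \<le> 0"
    proof (rule ccontr)
      assume "\<not> ?thesis"
      with DERIV_pos_inc_right[OF der[OF s01(1,2)]] obtain d where
        d: "d > 0" "\<And>h. 0 < h \<Longrightarrow> h < d \<Longrightarrow> \<rho> (\<gamma> s) < \<rho> (\<gamma> (s + h))" by auto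
      define h where "h = min (d / 2) (1 - s)"
      have "0 < h" "h < d" "s + h \<le> 1" using d(1) s1 by (auto simp: h_def min_def)
      then show False using d(2)[of h] neg[of "s + h"] s01 by simp
    qed
    have "\<gamma> ` closure {s<..1} \<subseteq> closure D"
    proof (rule image_closure_subset)
      show "continuous_on (closure {s<..1}) \<gamma>" unfolding \<gamma>_def by (intro continuous_intros)
      show "\<gamma> ` {s<..1} \<subseteq> closure D"
        using memD neg s01 closure_subset[of D] by force
    qed simp
    then have "?q \<in> closure D" using s1 by auto
    moreover have "?q \<notin> D" using memD s01 by auto
    ultimately show "?q \<in> frontier D" using opn by (simp add: frontier_def interior_open)
  qed
qed

lemma inner_unit_normal_eq:
  assumes "C1_smooth_bounded_domain G" "C1_defining_function G V \<rho> g" "x \<in> frontier G" "x \<in> V"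
  shows "inner_unit_normal G x = - sgn (g x)"
proof (rule is_inner_unit_normal_unique[OF _ assms(3) inner_unit_normal[OF assms(1,3)]])
  show "open G" using assms by (simp add: C1_smooth_bounded_domain_def is_domain_def)
  show "is_inner_unit_normal G x (- sgn (g x))"
    using assms by (auto simp: is_inner_unit_normal_def)
qed

lemma norm_inner_unit_normal:
  assumes "C1_smooth_bounded_domain G" "x \<in> frontier G"
  shows "norm (inner_unit_normal G x) = 1"
  using inner_unit_normal[OF assms]
  by (auto simp: is_inner_unit_normal_def C1_defining_function_def norm_sgn)

text \<open>At the crossing point \<open>q\<close> the vector \<open>z - \<zeta>\<close> has a nonnegative component along the inner normal, and
  the normals at \<open>q\<close> and \<open>\<zeta>\<close> differ by at most \<open>e\<close>. So \<open>D\<close> dips below its tangent line by no more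
  than the oscillation of the normal allows; only boundary points closer to \<open>\<zeta>\<close> than \<open>z\<close> matter,
  which suits a modulus of continuity defined with a strict inequality.\<close>

lemma inner_normal_ge:
  assumes G: "C1_defining_function (D \<inter> U) V \<rho> g" and C1: "C1_smooth_bounded_domain (D \<inter> U)"
    and opn: "open D" "open U"
    and \<zeta>: "\<zeta> \<in> frontier D" and z: "z \<in> D" and seg: "closed_segment \<zeta> z \<subseteq> U \<inter> V"
    and w: "\<And>q. q \<in> frontier D \<Longrightarrow> q \<in> closed_segment \<zeta> z \<Longrightarrow> dist q \<zeta> < dist z \<zeta> \<Longrightarrow>
      norm (inner_unit_normal (D \<inter> U) q - inner_unit_normal (D \<inter> U) \<zeta>) \<le> e"
  shows "- (norm (z - \<zeta>) * e) \<le> (z - \<zeta>) \<bullet> inner_unit_normal (D \<inter> U) \<zeta>"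
proof -
  let ?n = "inner_unit_normal (D \<inter> U)"
  obtain q where q: "q \<in> frontier D" "q \<in> closed_segment \<zeta> z" "dist q \<zeta> < dist z \<zeta>"
    "(z - \<zeta>) \<bullet> g q \<le> 0"
    using boundary_crossing[OF G opn \<zeta> z seg] by blast
  have "?n q = - sgn (g q)"
    using q seg by (intro inner_unit_normal_eq[OF C1 G] frontier_Int_open opn) auto
  then have "(z - \<zeta>) \<bullet> ?n q = - (inverse (norm (g q)) * ((z - \<zeta>) \<bullet> g q))"
    by (simp add: sgn_div_norm)
  then have "0 \<le> (z - \<zeta>) \<bullet> ?n q"
    using q(4) by (simp add: mult_nonneg_nonpos)
  moreover have "(z - \<zeta>) \<bullet> (?n q - ?n \<zeta>) \<le> norm (z - \<zeta>) * e"
    using norm_cauchy_schwarz[of "z - \<zeta>" "?n q - ?n \<zeta>"] w[OF q(1-3)]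
    by (meson mult_left_mono norm_ge_zero order_trans)
  ultimately show ?thesis by (simp add: inner_diff_right)
qed

section \<open>Barriers for perturbed half planes\<close>

text \<open>Coordinates are normalised so that the boundary point is \<open>0\<close> and the inner normal is the positive
  real direction. The domain may reach below the tangent line, by the relative amount \<open>w\<close>.\<close>

definition tangential_region :: "(real \<Rightarrow> real) \<Rightarrow> real \<Rightarrow> complex set" where
  "tangential_region w r = {p. 0 < norm p \<and> norm p < r \<and> - (norm p * w (norm p)) \<le> Re p}"

text \<open>The bound \<open>\<beta>\<close> is the decay rate that the squeezing function will inherit. The barrier \<open>h\<close> may depend on
  the distance \<open>\<delta>\<close> at which it is evaluated, but its lower bound \<open>c\<close> on the circle may not.\<close>

definition has_small_barriers :: "(real \<Rightarrow> real) \<Rightarrow> (real \<Rightarrow> real) \<Rightarrow> bool" where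
  "has_small_barriers w \<beta> \<longleftrightarrow>
     (\<forall>e>0. \<exists>r' r c. 0 < r \<and> r < r' \<and> r' \<le> e \<and> 0 < c \<and>
        (\<forall>\<delta>. 0 < \<delta> \<and> \<delta> < r \<longrightarrow>
           (\<exists>h. h holomorphic_on tangential_region w r' \<and>
              (\<forall>p\<in>tangential_region w r'. 0 \<le> Re (h p)) \<and>
              (\<forall>p\<in>tangential_region w r'. norm p = r \<longrightarrow> c \<le> Re (h p)) \<and>
              (\<forall>p\<in>tangential_region w r'. norm p = \<delta> \<longrightarrow> Re (h p) \<le> \<beta> \<delta>))))"

text \<open>If the normal oscillates little, the region is contained in a sector of half opening \<open>\<theta>\<close> slightly
  above \<open>pi / 2\<close>, in which \<open>p powr \<beta>\<close> has positive real part. The choice \<open>\<theta> = pi / (1 + \<beta>)\<close> gives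
  both \<open>pi / 2 < \<theta>\<close> and \<open>\<beta> * \<theta> < pi / 2\<close>.\<close>

lemma power_barriers:
  assumes "0 < \<beta>" "\<beta> < 1"
  obtains \<epsilon> where "\<epsilon> > 0" and "has_small_barriers (\<lambda>_. \<epsilon>) (\<lambda>\<delta>. \<delta> powr \<beta>)"
proof
  define \<theta> where "\<theta> = pi / (1 + \<beta>)"
  have \<theta>: "pi / 2 < \<theta>" "\<theta> < pi" "\<beta> * \<theta> < pi / 2"
    using assms by (auto simp: \<theta>_def field_simps)
  show \<epsilon>: "0 < - cos \<theta>"
    using cos_gt_zero_pi[of "pi - \<theta>"] \<theta> by simp
  have cpos: "0 < cos (\<beta> * \<theta>)"
    using \<theta> assms mult_pos_pos[of \<beta> \<theta>] pi_gt_zero by (intro cos_gt_zero_pi) linarith+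
  have eps1: "- cos \<theta> < 1"
    using cos_monotone_0_pi[of \<theta> pi] \<theta> by simp
  show "has_small_barriers (\<lambda>_. - cos \<theta>) (\<lambda>\<delta>. \<delta> powr \<beta>)"
    unfolding has_small_barriers_def
  proof (intro allI impI)
    fix e :: real assume e: "0 < e"
    let ?X = "tangential_region (\<lambda>_. - cos \<theta>) e"
    let ?h = "\<lambda>p::complex. p powr of_real \<beta>"
    have nonpos: "p \<notin> \<real>\<^sub>\<le>\<^sub>0" if "p \<in> ?X" for p
    proof
      assume "p \<in> \<real>\<^sub>\<le>\<^sub>0"
      then have "norm p = - Re p" by (auto simp: complex_nonpos_Reals_iff cmod_eq_Re)
      moreover have "norm p * - cos \<theta> < norm p * 1"
        using that eps1 by (intro mult_strict_left_mono) (auto simp: tangential_region_def)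
      ultimately show False using that by (auto simp: tangential_region_def)
    qed
    have low: "norm p powr \<beta> * cos (\<beta> * \<theta>) \<le> Re (?h p)" if p: "p \<in> ?X" for p
    proof -
      have p0: "p \<noteq> 0" "norm p > 0" using p by (auto simp: tangential_region_def)
      have "norm p * cos (Arg p) = Re p"
        using p0 by (metis Re_rcis rcis_cmod_Arg)
      moreover have "norm p * cos \<theta> \<le> Re p"
        using p by (simp add: tangential_region_def)
      ultimately have "norm p * cos \<theta> \<le> norm p * cos (Arg p)" by linarith
      then have "cos \<theta> \<le> cos (Arg p)" using p0(2) by (rule mult_left_le_imp_le)
      then have "cos \<theta> \<le> cos \<bar>Arg p\<bar>" by (cases "Arg p \<ge> 0") auto
      then have "\<bar>Arg p\<bar> \<le> \<theta>"
        using \<theta> Arg_bounded[of p] by (subst (asm) cos_mono_le_eq) auto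
      then have "cos (\<beta> * \<theta>) \<le> cos (\<beta> * \<bar>Arg p\<bar>)"
        using \<theta> assms mult_left_mono[of "\<bar>Arg p\<bar>" \<theta> \<beta>]
        by (intro cos_monotone_0_pi_le) auto
      also have "cos (\<beta> * \<bar>Arg p\<bar>) = cos (\<beta> * Arg p)"
        by (cases "Arg p \<ge> 0") auto
      finally have "norm p powr \<beta> * cos (\<beta> * \<theta>) \<le> norm p powr \<beta> * cos (\<beta> * Arg p)"
        by (intro mult_left_mono) auto
      also have "\<dots> = Re (?h p)"
        using p0 by (simp add: powr_def Re_exp Arg_eq_Im_Ln)
      finally show ?thesis .
    qed
    show "\<exists>r' r c. 0 < r \<and> r < r' \<and> r' \<le> e \<and> 0 < c \<and>
        (\<forall>\<delta>. 0 < \<delta> \<and> \<delta> < r \<longrightarrow>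
           (\<exists>h. h holomorphic_on tangential_region (\<lambda>_. - cos \<theta>) r' \<and>
              (\<forall>p\<in>tangential_region (\<lambda>_. - cos \<theta>) r'. 0 \<le> Re (h p)) \<and>
              (\<forall>p\<in>tangential_region (\<lambda>_. - cos \<theta>) r'. norm p = r \<longrightarrow> c \<le> Re (h p)) \<and>
              (\<forall>p\<in>tangential_region (\<lambda>_. - cos \<theta>) r'. norm p = \<delta> \<longrightarrow> Re (h p) \<le> \<delta> powr \<beta>)))"
    proof (rule exI[of _ e], rule exI[of _ "e/2"], rule exI[of _ "(e/2) powr \<beta> * cos (\<beta> * \<theta>)"],
        intro conjI allI impI exI[of _ ?h] ballI)
      show "?h holomorphic_on ?X" using nonpos by (intro holomorphic_intros) auto
      show "0 \<le> Re (?h p)" if "p \<in> ?X" for p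
        using low[OF that] mult_nonneg_nonneg[OF powr_ge_zero less_imp_le[OF cpos], of "norm p" \<beta>]
        by linarith
      show "(e/2) powr \<beta> * cos (\<beta> * \<theta>) \<le> Re (?h p)" if "p \<in> ?X" "norm p = e/2" for p
        using low[OF that(1)] that(2) by simp
      show "Re (?h p) \<le> \<delta> powr \<beta>" if "norm p = \<delta>" for p \<delta>
        using complex_Re_le_cmod[of "?h p"] that by (simp add: norm_powr_real_powr')
    qed (use e cpos in auto)
  qed
qed

text \<open>Building block of the Dini barrier. The function \<open>q = s p / (s + p)\<close>, with pole outside the region,
  is of size at most \<open>2 |p|\<close> everywhere; near the imaginary axis its real part is comparable to \<open>|p|\<close>
  when \<open>|p|\<close> is comparable to \<open>s\<close>, and at other scales it falls below \<open>0\<close> by at most twice the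
  negative part of \<open>Re p\<close>. So it lifts the barrier at the scale \<open>s\<close> only. Everything follows from
  \<open>Re q = s (s Re p + |p|\<^sup>2) / |s + p|\<^sup>2\<close>.\<close>

lemma pole_bounds:
  fixes p :: complex and s :: real
  assumes s: "s > 0" and p: "- (norm p / 2) \<le> Re p"
  defines "q \<equiv> of_real s * p / (of_real s + p)"
  shows "of_real s + p \<noteq> 0"
    and "2 * min (Re p) 0 \<le> Re q"
    and "s \<le> norm p \<Longrightarrow> norm p < 2 * s \<Longrightarrow> 2 * min (Re p) 0 + norm p / 8 \<le> Re q"
    and "norm q \<le> 2 * norm p"
proof -
  define m x Q where "m = norm p" and "x = Re p" and "Q = (norm (of_real s + p))\<^sup>2"
  have m0: "0 \<le> m" by (simp add: m_def)
  have m2: "m\<^sup>2 = x\<^sup>2 + (Im p)\<^sup>2" by (simp add: m_def x_def cmod_power2)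
  have Q: "Q = s\<^sup>2 + 2 * s * x + m\<^sup>2"
    by (simp add: Q_def m2 x_def cmod_power2 power2_sum)
  have "2 * s * (- (m / 2)) \<le> 2 * s * x"
    using p s by (intro mult_left_mono) (auto simp: m_def x_def)
  moreover have "2 * (s * m) \<le> s\<^sup>2 + m\<^sup>2" using sum_squares_bound[of s m] by simp
  ultimately have Qlow: "s\<^sup>2 + m\<^sup>2 \<le> 2 * Q" unfolding Q by simp
  have sQ: "s\<^sup>2 \<le> 2 * Q" using Qlow zero_le_power2[of m] by linarith
  moreover have "0 < s\<^sup>2" using s by simp
  ultimately have Qpos: "Q > 0" by linarith
  then show nz: "of_real s + p \<noteq> 0" by (auto simp: Q_def)
  have "of_real Q = (of_real s + p) * cnj (of_real s + p)"
    unfolding Q_def by (rule complex_norm_square)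
  moreover have "cnj (of_real s + p) \<noteq> 0" using nz by (simp only: complex_cnj_zero_iff not_False_eq_True)
  ultimately have "q = of_real s * p * cnj (of_real s + p) / of_real Q"
    unfolding q_def by (simp only: nonzero_mult_divide_mult_cancel_right not_False_eq_True)
  then have Req: "Re q = (s\<^sup>2 * x + s * m\<^sup>2) / Q"
    by (simp add: Re_divide_of_real m2[unfolded power2_eq_square] x_def power2_eq_square algebra_simps)
  have A: "2 * min x 0 \<le> s\<^sup>2 * x / Q"
  proof (cases "x \<ge> 0")
    case False
    have "2 * Q * x \<le> s\<^sup>2 * x" using sQ False by (intro mult_right_mono_neg) auto
    then show ?thesis using False Qpos by (simp add: field_simps)
  qed (use Qpos in auto)
  have dec: "Re q = s\<^sup>2 * x / Q + s * m\<^sup>2 / Q" by (simp add: Req add_divide_distrib)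
  have "0 \<le> s * m\<^sup>2 / Q" using s Qpos by simp
  with A dec show "2 * min (Re p) 0 \<le> Re q" unfolding x_def by linarith
  show "2 * min (Re p) 0 + norm p / 8 \<le> Re q" if "s \<le> norm p" "norm p < 2 * s"
  proof -
    have sm: "s \<le> m" "m < 2 * s" "m > 0" using that s by (auto simp: m_def)
    have "x \<le> m" by (simp add: x_def m_def complex_Re_le_cmod)
    then have "Q \<le> s\<^sup>2 + 2 * s * m + m\<^sup>2" unfolding Q using s by simp
    also have "\<dots> = (s + m)\<^sup>2" by (simp add: power2_eq_square algebra_simps)
    also have "\<dots> \<le> (2 * m)\<^sup>2" using sm s by (intro power_mono) auto
    finally have "Q \<le> 4 * m\<^sup>2" by (simp add: power2_eq_square)
    then have "m / 8 * Q \<le> m / 8 * (4 * m\<^sup>2)" using sm by (intro mult_left_mono) auto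
    also have "\<dots> = m / 2 * m\<^sup>2" by simp
    also have "\<dots> \<le> s * m\<^sup>2" using sm by (intro mult_right_mono) auto
    finally have "m / 8 \<le> s * m\<^sup>2 / Q" using Qpos by (simp add: field_simps)
    with A dec show ?thesis unfolding x_def m_def by linarith
  qed
  have "s\<^sup>2 \<le> 4 * Q" using sQ Qpos by linarith
  then have "s\<^sup>2 \<le> (2 * norm (of_real s + p))\<^sup>2"
    by (simp add: Q_def power_mult_distrib)
  then have "s \<le> 2 * norm (of_real s + p)"
    by (rule power2_le_imp_le) simp
  then have "s * m \<le> 2 * norm (of_real s + p) * m" using m0 by (intro mult_right_mono)
  then show "norm q \<le> 2 * norm p"
    using nz s by (simp add: q_def norm_divide norm_mult m_def field_simps)
qed

lemma dyadic_scale: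
  fixes m :: real
  assumes "0 < m" "m < (1/2)^k0"
  obtains k where "k0 < k" "(1/2)^k \<le> m" "m < 2 * (1/2)^k"
proof -
  have ex: "\<exists>k. (1/2::real)^k \<le> m"
    using real_arch_pow_inv[of m "1/2"] assms by (auto intro: less_imp_le)
  define k where "k = (LEAST k. (1/2::real)^k \<le> m)"
  have k: "(1/2::real)^k \<le> m" unfolding k_def using ex by (rule LeastI_ex)
  have "(1/2::real)^k < (1/2)^k0" using k assms(2) by (rule le_less_trans)
  then have kk: "k0 < k"
    by (rule contrapos_pp) (simp add: power_decreasing not_less)
  then obtain j where j: "k = Suc j" by (cases k) auto
  have "\<not> (1/2::real)^j \<le> m"
    using not_less_Least[of j "\<lambda>k. (1/2::real)^k \<le> m"] j k_def by simp
  then show thesis using that[of k] kk k j by simp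
qed

text \<open>The function \<open>Re p\<close> is a barrier for the half plane; on the region it can be negative, but by no more than
  \<open>|p| w |p|\<close>. At each dyadic scale \<open>s\<close> this deficit is repaired by a multiple, governed by \<open>w (2 s)\<close>, of the
  building block of scale \<open>s\<close>. The total cost is the sum of the coefficients, which the Dini condition
  makes finite, and small after discarding large scales. Scales below \<open>\<delta>\<close> are handled by adding the constant \<open>\<delta>\<close>,
  which does no harm when the barrier is evaluated at distance \<open>\<delta>\<close> and keeps the sum finite.\<close>

lemma Dini_barriers:
  fixes w :: "real \<Rightarrow> real"
  assumes nonneg: "\<And>t. t > 0 \<Longrightarrow> 0 \<le> w t"
    and mono: "\<And>s t. 0 < s \<Longrightarrow> s \<le> t \<Longrightarrow> w s \<le> w t"
    and sum: "summable (\<lambda>k. w ((1/2)^k))"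
  shows "has_small_barriers w (\<lambda>\<delta>. 3 * \<delta>)"
  unfolding has_small_barriers_def
proof (intro allI impI)
  fix e :: real assume e: "0 < e"
  \<comment> \<open>The extra \<open>t\<close> keeps the barrier positive on the circle even where \<open>w\<close> vanishes.\<close>
  define v where "v t = w t + t" for t
  have v0: "0 < v t" if "t > 0" for t using nonneg[OF that] that by (simp add: v_def)
  have vmono: "v s \<le> v t" if "0 < s" "s \<le> t" for s t using mono[OF that] that by (simp add: v_def)
  have vsum: "summable (\<lambda>k. v ((1/2)^k))"
    unfolding v_def by (intro summable_add sum summable_geometric) auto
  have "(\<lambda>i. \<Sum>k. v ((1/2)^(k + i))) \<longlonglongrightarrow> 0"
    using vsum by (rule suminf_exist_split2)
  then have "\<forall>\<^sub>F i in sequentially. (\<Sum>k. v ((1/2)^(k + i))) < 1/64"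
    by (rule order_tendstoD) simp
  moreover have "\<forall>\<^sub>F i in sequentially. (1/2::real)^i < e"
    using e by (intro order_tendstoD[OF LIMSEQ_power_zero]) auto
  ultimately have "\<forall>\<^sub>F i in sequentially. (\<Sum>k. v ((1/2)^(k + i))) < 1/64 \<and> (1/2::real)^i < e"
    by eventually_elim simp
  then obtain k0 where k0: "(\<Sum>k. v ((1/2)^(k + k0))) < 1/64" "(1/2::real)^k0 < e"
    by (auto simp: eventually_sequentially)
  have vsum0: "summable (\<lambda>k. v ((1/2)^(k + k0)))"
    using vsum summable_iff_shift[of "\<lambda>k. v ((1/2)^k)" k0] by simp
  have part: "(\<Sum>k\<in>{k0<..N}. v (2 * (1/2)^k)) \<le> 1/64" for N
  proof -
    have half: "(1/2::real)^(k - Suc 0) = 2 * (1/2)^k" if "k0 < k" for k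
      using that by (cases k) auto
    have "(\<Sum>k\<in>{k0<..N}. v (2 * (1/2)^k)) = (\<Sum>j\<in>{..<N - k0}. v ((1/2)^(j + k0)))"
      by (rule sum.reindex_bij_witness[of _ "\<lambda>j. Suc (j + k0)" "\<lambda>k. k - Suc k0"])
        (auto simp: less_diff_conv Suc_diff_Suc half)
    also have "\<dots> \<le> (\<Sum>k. v ((1/2)^(k + k0)))"
      using vsum0 by (rule sum_le_suminf) (auto intro!: less_imp_le v0)
    finally show ?thesis using k0 by simp
  qed
  let ?r' = "(1/2::real)^k0" and ?r = "(1/2::real)^k0 / 2"
  let ?X = "tangential_region w ?r'"
  have v64: "v ?r' \<le> 1/64"
  proof -
    have "{k0<..Suc k0} = {Suc k0}" by auto
    then show ?thesis using part[of "Suc k0"] by simp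
  qed
  have X: "0 < norm p" "norm p < ?r'" "- (norm p * w (norm p)) \<le> Re p" "w (norm p) \<le> 1/64"
     "- (norm p / 2) \<le> Re p" if "p \<in> ?X" for p
  proof -
    show 1: "0 < norm p" "norm p < ?r'" "- (norm p * w (norm p)) \<le> Re p"
      using that by (auto simp: tangential_region_def)
    have "w (norm p) \<le> v (norm p)" using 1 by (simp add: v_def)
    also have "\<dots> \<le> v ?r'" using 1 by (intro vmono) auto
    finally show 2: "w (norm p) \<le> 1/64" using v64 by simp
    have "norm p * w (norm p) \<le> norm p * (1/2)" using 1 2 by (intro mult_left_mono) auto
    with 1(3) show "- (norm p / 2) \<le> Re p" by simp
  qed
  show "\<exists>r' r c. 0 < r \<and> r < r' \<and> r' \<le> e \<and> 0 < c \<and>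
        (\<forall>\<delta>. 0 < \<delta> \<and> \<delta> < r \<longrightarrow>
           (\<exists>h. h holomorphic_on tangential_region w r' \<and>
              (\<forall>p\<in>tangential_region w r'. 0 \<le> Re (h p)) \<and>
              (\<forall>p\<in>tangential_region w r'. norm p = r \<longrightarrow> c \<le> Re (h p)) \<and>
              (\<forall>p\<in>tangential_region w r'. norm p = \<delta> \<longrightarrow> Re (h p) \<le> 3 * \<delta>)))"
  proof (rule exI[of _ ?r'], rule exI[of _ ?r], rule exI[of _ "2 * ?r\<^sup>2"],
      intro conjI allI impI; (elim conjE)?)
    fix \<delta> assume \<delta>: "0 < \<delta>" "\<delta> < ?r"
    obtain N where N: "(1/2::real)^N < \<delta>" using real_arch_pow_inv[of \<delta> "1/2"] \<delta> by auto
    define s where "s k = (1/2::real)^k" for k :: nat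
    \<comment> \<open>Factor 8 undoes the loss in the building block; factor 2 covers \<open>Re p\<close> plus the negative parts.\<close>
    define \<alpha> where "\<alpha> k = 16 * v (2 * s k)" for k
    define q where "q k p = of_real (s k) * p / (of_real (s k) + p)" for k and p :: complex
    define h where "h p = p + of_real \<delta> + (\<Sum>k\<in>{k0<..N}. of_real (\<alpha> k) * q k p)" for p
    have s: "s k > 0" for k by (simp add: s_def)
    have \<alpha>: "\<alpha> k > 0" for k using v0[of "2 * s k"] s[of k] by (simp add: \<alpha>_def)
    define A where "A = (\<Sum>k\<in>{k0<..N}. \<alpha> k)"
    have A: "A \<le> 1/4"
      using part[of N] by (simp add: A_def \<alpha>_def s_def sum_distrib_left[symmetric])
    note pb = pole_bounds[OF s X(5), folded q_def]
    have Reh: "Re (h p) = Re p + \<delta> + (\<Sum>k\<in>{k0<..N}. \<alpha> k * Re (q k p))" for p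
      by (simp add: h_def)
    have sm: "2 * min (Re p) 0 * A \<le> (\<Sum>k\<in>{k0<..N}. \<alpha> k * Re (q k p))" if "p \<in> ?X" for p
    proof -
      have "2 * min (Re p) 0 * A = (\<Sum>k\<in>{k0<..N}. \<alpha> k * (2 * min (Re p) 0))"
        by (simp add: A_def sum_distrib_left sum_distrib_right mult.commute)
      also have "\<dots> \<le> (\<Sum>k\<in>{k0<..N}. \<alpha> k * Re (q k p))"
        using pb(2)[OF that] \<alpha> by (intro sum_mono mult_left_mono) (auto intro: less_imp_le)
      finally show ?thesis .
    qed
    have neg: "- (2 * norm p * w (norm p)) \<le> Re p + 2 * min (Re p) 0 * A" if "p \<in> ?X" for p
    proof (cases "Re p \<ge> 0")
      case True
      have "0 \<le> norm p * w (norm p)" using nonneg[OF X(1)[OF that]] by simp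
      then show ?thesis using True by simp
    next
      case False
      have "A * (2 * Re p) \<ge> 1/4 * (2 * Re p)" using A False by (intro mult_right_mono_neg) auto
      then have "2 * Re p \<le> Re p + 2 * min (Re p) 0 * A" using False by (simp add: mult.commute)
      then show ?thesis using X(3)[OF that] by linarith
    qed
    have large: "2 * (norm p)\<^sup>2 \<le> Re (h p)" if p: "p \<in> ?X" and m: "\<delta> < norm p" for p
    proof -
      obtain k where k: "k0 < k" "s k \<le> norm p" "norm p < 2 * s k"
        using dyadic_scale[OF X(1,2)[OF p]] unfolding s_def by metis
      have "(1/2::real)^N < (1/2)^k * 2" using N m k by (simp add: s_def)
      then have "(1/2::real)^Suc N < (1/2)^k" by simp
      then have "k < Suc N" by (subst (asm) power_strict_decreasing_iff) auto
      then have kI: "k \<in> {k0<..N}" using k by simp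
      have "2 * min (Re p) 0 * A + \<alpha> k * (norm p / 8)
          = (\<Sum>j\<in>{k0<..N}. \<alpha> j * (2 * min (Re p) 0) + (if j = k then \<alpha> k * (norm p / 8) else 0))"
        using kI by (simp add: A_def sum.distrib sum_distrib_left sum_distrib_right mult.commute)
      also have "\<dots> \<le> (\<Sum>j\<in>{k0<..N}. \<alpha> j * Re (q j p))"
      proof (rule sum_mono)
        fix j
        show "\<alpha> j * (2 * min (Re p) 0) + (if j = k then \<alpha> k * (norm p / 8) else 0) \<le> \<alpha> j * Re (q j p)"
        proof (cases "j = k")
          case True
          have "\<alpha> k * (2 * min (Re p) 0 + norm p / 8) \<le> \<alpha> k * Re (q k p)"
            using pb(3)[OF p k(2,3)] \<alpha>[of k] by (intro mult_left_mono) auto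
          then show ?thesis using True by (simp add: distrib_left)
        next
          case False
          then show ?thesis using pb(2)[OF p] \<alpha>[of j] by (simp add: mult_left_mono)
        qed
      qed
      finally have 1: "- (2 * norm p * w (norm p)) + \<delta> + \<alpha> k * (norm p / 8) \<le> Re (h p)"
        unfolding Reh using neg[OF p] by linarith
      have "v (norm p) \<le> v (2 * s k)" using k X(1)[OF p] by (intro vmono) auto
      then have "2 * v (norm p) * norm p \<le> \<alpha> k * (norm p / 8)"
        using X(1)[OF p] by (simp add: \<alpha>_def mult_right_mono)
      then have "2 * norm p * w (norm p) + 2 * (norm p)\<^sup>2 \<le> \<alpha> k * (norm p / 8)"
        by (simp add: v_def power2_eq_square algebra_simps)
      with 1 \<delta> show ?thesis by linarith
    qed
    show "\<exists>h. h holomorphic_on ?X \<and> (\<forall>p\<in>?X. 0 \<le> Re (h p)) \<and>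
              (\<forall>p\<in>?X. norm p = ?r \<longrightarrow> 2 * ?r\<^sup>2 \<le> Re (h p)) \<and>
              (\<forall>p\<in>?X. norm p = \<delta> \<longrightarrow> Re (h p) \<le> 3 * \<delta>)"
    proof (intro exI[of _ h] conjI ballI impI)
      show "h holomorphic_on ?X"
        unfolding h_def q_def using pole_bounds(1)[OF s X(5)] by (intro holomorphic_intros) auto
      fix p assume p: "p \<in> ?X"
      show "0 \<le> Re (h p)"
      proof (cases "\<delta> < norm p")
        case True
        then show ?thesis using large[OF p] zero_le_power2[of "norm p"] by linarith
      next
        case False
        have "norm p * w (norm p) \<le> \<delta> * (1/64)"
          using False X[OF p] nonneg \<delta> by (intro mult_mono) auto
        then show ?thesis unfolding Reh using neg[OF p] sm[OF p] \<delta> by linarith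
      qed
      show "2 * ?r\<^sup>2 \<le> Re (h p)" if "norm p = ?r" using large[OF p] that \<delta> by simp
      show "Re (h p) \<le> 3 * \<delta>" if m: "norm p = \<delta>"
      proof -
        have "(\<Sum>k\<in>{k0<..N}. \<alpha> k * Re (q k p)) \<le> (\<Sum>k\<in>{k0<..N}. \<alpha> k * (2 * \<delta>))"
        proof (intro sum_mono mult_left_mono)
          show "Re (q k p) \<le> 2 * \<delta>" for k
            using pb(4)[OF p, of k] m complex_Re_le_cmod[of "q k p"] by simp
        qed (use \<alpha> less_imp_le in auto)
        also have "\<dots> = A * (2 * \<delta>)" by (simp add: A_def sum_distrib_right)
        also have "\<dots> \<le> 1/4 * (2 * \<delta>)" using A \<delta> by (intro mult_right_mono) auto
        finally show ?thesis unfolding Reh using m complex_Re_le_cmod[of p] \<delta> by linarith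
      qed
    qed
  qed (use k0 in auto)
qed

section \<open>The Dini condition at dyadic scales\<close>

text \<open>On the dyadic interval \<open>I k\<close> the integrand is at least \<open>w ((1/2)^Suc k) * 2^k\<close>, and the interval has length
  \<open>(1/2)^Suc k\<close>; so half of \<open>w ((1/2)^Suc k)\<close> is paid for by the integral over \<open>I k\<close>.\<close>

lemma summable_of_Dini_integral:
  fixes w :: "real \<Rightarrow> real"
  assumes nonneg: "\<And>t. t > 0 \<Longrightarrow> 0 \<le> w t"
    and mono: "\<And>s t. 0 < s \<Longrightarrow> s \<le> t \<Longrightarrow> w s \<le> w t"
    and fin: "(\<integral>\<^sup>+t\<in>{0<..1}. ennreal (w t / t) \<partial>lborel) < \<infinity>"
  shows "summable (\<lambda>k. w ((1/2)^k))"
proof -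
  define I where "I k = {(1/2::real)^Suc k <.. (1/2)^k}" for k :: nat
  define f where "f k t = ennreal (w ((1/2)^Suc k) * 2^k) * indicator (I k) t" for k and t :: real
  have disj: "j = k" if "t \<in> I j" "t \<in> I k" for j k t
  proof (rule ccontr)
    assume "j \<noteq> k"
    then have "Suc j \<le> k \<or> Suc k \<le> j" by linarith
    then have "(1/2::real)^k \<le> (1/2)^Suc j \<or> (1/2::real)^j \<le> (1/2)^Suc k"
      by (metis power_decreasing half_gt_zero_iff less_imp_le zero_less_one half_bounded_equal
          le_numeral_extra(4) divide_le_eq_1 one_le_numeral zero_less_numeral)
    then show False using that unfolding I_def greaterThanAtMost_iff by linarith
  qed
  have pt: "(\<Sum>k. f k t) \<le> ennreal (w t / t) * indicator {0<..1} t" for t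
  proof (cases "\<exists>k. t \<in> I k")
    case True
    then obtain k where k: "t \<in> I k" by blast
    have "(\<Sum>j. f j t) = (\<Sum>j\<in>{k}. f j t)"
      by (rule suminf_finite) (use k disj in \<open>auto simp: f_def indicator_def\<close>)
    also have "\<dots> = ennreal (w ((1/2)^Suc k) * 2^k)" using k by (simp add: f_def)
    also have "\<dots> \<le> ennreal (w t / t)"
    proof (rule ennreal_leI)
      have t: "(1/2)^Suc k < t" "t \<le> (1/2)^k" using k by (auto simp: I_def)
      have t0: "0 < t" using t(1) zero_less_power[of "1/2::real" "Suc k"] by linarith
      have "w ((1/2)^Suc k) * 2^k \<le> w t * (1 / t)"
      proof (rule mult_mono)
        show "w ((1/2)^Suc k) \<le> w t" using t by (intro mono) auto
        have "t * 2^k \<le> (1/2)^k * 2^k" using t by (intro mult_right_mono) auto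
        then show "2^k \<le> 1 / t" using t0 by (simp add: field_simps power_divide)
      qed (use nonneg t0 in auto)
      then show "w ((1/2)^Suc k) * 2^k \<le> w t / t" by simp
    qed
    also have "\<dots> = ennreal (w t / t) * indicator {0<..1} t"
    proof -
      have "(1/2)^Suc k < t" "t \<le> (1/2)^k" using k by (auto simp: I_def)
      moreover have "0 < (1/2::real)^Suc k" "(1/2::real)^k \<le> 1" by (simp_all add: power_le_one)
      ultimately have "t \<in> {0<..1}" unfolding greaterThanAtMost_iff by linarith
      then show ?thesis by simp
    qed
    finally show ?thesis .
  next
    case False
    then have "f k t = 0" for k by (auto simp: f_def)
    then show ?thesis by simp
  qed
  have "(\<Sum>k. \<integral>\<^sup>+t. f k t \<partial>lborel) = (\<integral>\<^sup>+t. (\<Sum>k. f k t) \<partial>lborel)"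
    by (rule nn_integral_suminf[symmetric]) (auto simp: f_def I_def)
  also have "\<dots> \<le> (\<integral>\<^sup>+t\<in>{0<..1}. ennreal (w t / t) \<partial>lborel)"
    by (intro nn_integral_mono pt)
  finally have "(\<Sum>k. \<integral>\<^sup>+t. f k t \<partial>lborel) < \<infinity>" using fin by (rule le_less_trans)
  moreover have "(\<integral>\<^sup>+t. f k t \<partial>lborel) = ennreal (w ((1/2)^Suc k) / 2)" for k
  proof -
    have "(\<integral>\<^sup>+t. f k t \<partial>lborel) = ennreal (w ((1/2)^Suc k) * 2^k) * emeasure lborel (I k)"
      unfolding f_def by (rule nn_integral_cmult_indicator) (simp add: I_def)
    also have "emeasure lborel (I k) = ennreal ((1/2)^Suc k)"
      unfolding I_def by (subst emeasure_lborel_Ioc) auto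
    also have "ennreal (w ((1/2)^Suc k) * 2^k) * ennreal ((1/2)^Suc k)
        = ennreal (w ((1/2)^Suc k) * 2^k * (1/2)^Suc k)"
      by (rule ennreal_mult[symmetric]) (use nonneg in auto)
    also have "w ((1/2)^Suc k) * 2^k * (1/2)^Suc k = w ((1/2)^Suc k) / 2"
      by (simp add: power_divide)
    finally show ?thesis .
  qed
  ultimately have "(\<Sum>k. ennreal (w ((1/2)^Suc k) / 2)) \<noteq> top" by simp
  then have "summable (\<lambda>k. w ((1/2)^Suc k) / 2)"
    by (intro summable_suminf_not_top) (use nonneg in auto)
  then have "summable (\<lambda>k. w ((1/2)^Suc k))"
    using summable_mult[of _ 2] by fastforce
  then show ?thesis by (subst (asm) summable_Suc_iff)
qed

lemma normal_modulus_bounds: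
  assumes G: "C1_smooth_bounded_domain G"
  shows "x \<in> frontier G \<Longrightarrow> y \<in> frontier G \<Longrightarrow> dist x y < t \<Longrightarrow>
      norm (inner_unit_normal G x - inner_unit_normal G y) \<le> normal_modulus G t"
    and "frontier G \<noteq> {} \<Longrightarrow> t > 0 \<Longrightarrow> 0 \<le> normal_modulus G t"
    and "frontier G \<noteq> {} \<Longrightarrow> 0 < s \<Longrightarrow> s \<le> t \<Longrightarrow> normal_modulus G s \<le> normal_modulus G t"
proof -
  define S where "S t = {norm (inner_unit_normal G x - inner_unit_normal G y) | x y.
            norm (x - y) < t \<and> x \<in> frontier G \<and> y \<in> frontier G}" for t
  have S: "normal_modulus G t = Sup (S t)" for t by (simp add: normal_modulus_def S_def)
  have "norm (inner_unit_normal G x - inner_unit_normal G y) \<le> 2"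
    if "x \<in> frontier G" "y \<in> frontier G" for x y
    using norm_triangle_ineq4[of "inner_unit_normal G x" "inner_unit_normal G y"]
      norm_inner_unit_normal[OF G] that by simp
  then have bdd: "bdd_above (S t)" for t
    by (intro bdd_aboveI[of _ 2]) (auto simp: S_def)
  show "norm (inner_unit_normal G x - inner_unit_normal G y) \<le> normal_modulus G t"
    if "x \<in> frontier G" "y \<in> frontier G" "dist x y < t" for x y t
    unfolding S using that bdd by (intro cSup_upper) (auto simp: S_def dist_norm)
  have zero: "0 \<in> S t" if "frontier G \<noteq> {}" "t > 0" for t
    using that unfolding S_def by force
  show "0 \<le> normal_modulus G t" if "frontier G \<noteq> {}" "t > 0"
    unfolding S using zero[OF that] bdd by (intro cSup_upper)
  show "normal_modulus G s \<le> normal_modulus G t" if "frontier G \<noteq> {}" "0 < s" "s \<le> t"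
    unfolding S using zero[OF that(1,2)] bdd that(3)
    by (intro cSup_subset_mono) (auto simp: S_def intro: less_le_trans)
qed

section \<open>From barriers to the boundary behaviour\<close>

text \<open>For \<open>z\<close> near \<open>a\<close> take a nearest boundary point \<open>\<zeta>\<close> and place the model barrier there, turned by the
  inner normal at \<open>\<zeta>\<close>. Then \<open>z\<close> has norm \<open>\<delta>\<close> in the model coordinates, whatever its direction, and all
  constants are uniform in \<open>\<zeta>\<close>. The estimate is the lower bound \<open>exp (- x) \<ge> 1 - x\<close> applied to the
  barrier bound.\<close>

theorem squeezing_function_le_of_barriers:
  assumes opn: "open D" "open U" and a: "a \<in> frontier D" "a \<in> U"
    and C1: "C1_smooth_bounded_domain (D \<inter> U)"
    and \<eta>: "\<eta> > 0"
    and w: "\<And>x y t. x \<in> frontier D \<inter> ball a \<eta> \<inter> U \<Longrightarrow> y \<in> frontier D \<inter> ball a \<eta> \<inter> U \<Longrightarrow> dist x y < t \<Longrightarrow>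
      norm (inner_unit_normal (D \<inter> U) x - inner_unit_normal (D \<inter> U) y) \<le> w t"
    and barriers: "has_small_barriers w \<beta>"
  obtains C where "C \<ge> 0"
    and "\<forall>\<^sub>F z in at a within D. 1 - squeezing_function D z \<le> C * \<beta> (boundary_dist D z)"
proof -
  have "a \<in> frontier (D \<inter> U)" using frontier_Int_open[OF opn a(2,1)] .
  then obtain V \<rho> g where V: "a \<in> V" and def: "C1_defining_function (D \<inter> U) V \<rho> g"
    using C1 unfolding C1_smooth_bounded_domain_def by blast
  have Vo: "open V" "continuous_on V g" "g a \<noteq> 0"
    using def V by (auto simp: C1_defining_function_def)
  have "(g \<longlongrightarrow> g a) (at a)"
    using Vo V by (simp add: continuous_on_eq_continuous_at isCont_def)
  then have "(g \<longlongrightarrow> g a) (nhds a)" by (simp only: tendsto_at_iff_tendsto_nhds)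
  then have "\<forall>\<^sub>F z in nhds a. dist (g z) (g a) < norm (g a) / 16"
    using Vo by (intro tendstoD) auto
  moreover have "\<forall>\<^sub>F z in nhds a. z \<in> U \<inter> V \<inter> ball a \<eta>"
    using opn Vo V a \<eta> by (intro eventually_nhds_in_open) auto
  ultimately have "\<forall>\<^sub>F z in nhds a. dist (g z) (g a) < norm (g a) / 16 \<and> z \<in> U \<inter> V \<inter> ball a \<eta>"
    by (rule eventually_conj)
  then obtain e where e: "e > 0"
    "\<And>z. dist z a < e \<Longrightarrow> dist (g z) (g a) < norm (g a) / 16 \<and> z \<in> U \<inter> V \<inter> ball a \<eta>"
    unfolding eventually_nhds_metric by blast
  define R where "R = e / 2"
  have R: "R > 0" using e by (simp add: R_def)
  have Rball: "dist (g z) (g a) < norm (g a) / 16 \<and> z \<in> U \<inter> V \<inter> ball a \<eta>" if "z \<in> cball a R" for z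
    using that e by (intro e(2)) (auto simp: R_def dist_commute)
  have sub: "cball a R \<subseteq> U \<inter> V" using Rball by blast
  obtain b where b: "b \<in> interior (cball a R - D)"
    and star: "\<And>z. z \<in> cball a R - D \<Longrightarrow> closed_segment b z \<subseteq> cball a R - D"
    using starlike_obstacle[OF def opn a(1) R sub] Rball by (metis dist_norm less_imp_le)
  obtain M where M: "M > 0"
    and bound: "\<And>\<zeta> r c H z. \<lbrakk>barrier_at D \<zeta> r c H; \<zeta> \<in> ball a (R/4); 0 < r; r \<le> R/4; 0 < c;
        z \<in> D \<inter> ball \<zeta> r\<rbrakk> \<Longrightarrow> exp (- (M / c) * Re (H z)) \<le> squeezing_function D z"
    using squeezing_function_barrier_bound[OF opn(1) R b star] by blast
  obtain r' r c where r: "0 < r" "r < r'" "r' \<le> R/4" "0 < c"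
    and h: "\<And>\<delta>. 0 < \<delta> \<Longrightarrow> \<delta> < r \<Longrightarrow> \<exists>h. h holomorphic_on tangential_region w r' \<and>
              (\<forall>p\<in>tangential_region w r'. 0 \<le> Re (h p)) \<and>
              (\<forall>p\<in>tangential_region w r'. norm p = r \<longrightarrow> c \<le> Re (h p)) \<and>
              (\<forall>p\<in>tangential_region w r'. norm p = \<delta> \<longrightarrow> Re (h p) \<le> \<beta> \<delta>)"
  proof -
    have "0 < R/4" using R by simp
    with barriers show thesis unfolding has_small_barriers_def using that by metis
  qed
  let ?n = "inner_unit_normal (D \<inter> U)"
  have est: "1 - squeezing_function D z \<le> M / c * \<beta> (boundary_dist D z)"
    if z: "z \<in> D" "dist z a < min r (R/8)" for z
  proof -
    define \<delta> where "\<delta> = boundary_dist D z"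
    have "\<delta> \<le> dist z a" unfolding \<delta>_def boundary_dist_def using a(1) by (rule infdist_le)
    then have \<delta>r: "\<delta> < r" "\<delta> < R/8" using z by auto
    obtain \<zeta> where \<zeta>: "\<zeta> \<in> frontier D" "\<delta> = dist z \<zeta>"
      using infdist_attains_inf[of "frontier D" z] a(1) unfolding \<delta>_def boundary_dist_def by auto
    have "\<zeta> \<notin> D" using \<zeta> opn by (simp add: frontier_def interior_open)
    then have \<delta>0: "0 < \<delta>" using \<zeta> z by auto
    have \<zeta>a: "\<zeta> \<in> ball a (R/4)"
      using dist_triangle[of a \<zeta> z] z \<zeta> \<delta>r by (simp add: dist_commute)
    then have \<zeta>R: "\<zeta> \<in> cball a R" using R by simp
    then have \<zeta>U: "\<zeta> \<in> U" using sub by auto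
    have n1: "norm (?n \<zeta>) = 1"
      using norm_inner_unit_normal[OF C1] frontier_Int_open[OF opn \<zeta>U \<zeta>(1)] by blast
    obtain h where h: "h holomorphic_on tangential_region w r'"
       "\<And>p. p \<in> tangential_region w r' \<Longrightarrow> 0 \<le> Re (h p)"
       "\<And>p. p \<in> tangential_region w r' \<Longrightarrow> norm p = r \<Longrightarrow> c \<le> Re (h p)"
       "\<And>p. p \<in> tangential_region w r' \<Longrightarrow> norm p = \<delta> \<Longrightarrow> Re (h p) \<le> \<beta> \<delta>"
      using h[OF \<delta>0 \<delta>r(1)] by blast
    define P where "P u = (u - \<zeta>) * cnj (?n \<zeta>)" for u
    have nP: "norm (P u) = dist \<zeta> u" for u
      by (simp add: P_def norm_mult n1 dist_norm norm_minus_commute)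
    have ReP: "Re (P u) = (u - \<zeta>) \<bullet> ?n \<zeta>" for u by (simp add: P_def inner_complex_def)
    have region: "P u \<in> tangential_region w r'" if u: "u \<in> D" "dist \<zeta> u < r'" for u
    proof -
      have "dist a u \<le> dist a \<zeta> + dist \<zeta> u" by (rule dist_triangle)
      then have "u \<in> cball a R" using \<zeta>a u r R by simp
      then have seg: "closed_segment \<zeta> u \<subseteq> cball a R"
        by (rule closed_segment_subset[OF \<zeta>R _ convex_cball])
      have "- (norm (u - \<zeta>) * w (norm (u - \<zeta>))) \<le> (u - \<zeta>) \<bullet> ?n \<zeta>"
      proof (rule inner_normal_ge[OF def C1 opn \<zeta>(1) u(1)])
        show "closed_segment \<zeta> u \<subseteq> U \<inter> V" using seg sub by blast
        fix q assume q: "q \<in> frontier D" "q \<in> closed_segment \<zeta> u" "dist q \<zeta> < dist u \<zeta>"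
        then have "q \<in> cball a R" using seg by blast
        then show "norm (?n q - ?n \<zeta>) \<le> w (norm (u - \<zeta>))"
          using w[of q \<zeta> "dist u \<zeta>"] q \<zeta> \<zeta>R Rball by (auto simp: dist_norm)
      qed
      moreover
      have "u \<noteq> \<zeta>" using u \<open>\<zeta> \<notin> D\<close> by auto
      then have "P u \<noteq> 0" using n1 by (auto simp: P_def)
      ultimately show ?thesis
        using u by (simp add: tangential_region_def nP ReP dist_norm norm_minus_commute)
    qed
    have bar: "barrier_at D \<zeta> r c (h \<circ> P)"
      unfolding barrier_at_def
    proof (intro conjI exI[of _ r'] ballI)
      have "P holomorphic_on D \<inter> ball \<zeta> r'" unfolding P_def by (intro holomorphic_intros)
      then show "(h \<circ> P) holomorphic_on D \<inter> ball \<zeta> r'"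
        using h(1) by (rule holomorphic_on_compose_gen) (use region in auto)
      show "0 \<le> Re ((h \<circ> P) u)" if "u \<in> D \<inter> ball \<zeta> r'" for u
        using h(2) region that by auto
      show "c \<le> Re ((h \<circ> P) u)" if "u \<in> D \<inter> sphere \<zeta> r" for u
        using h(3) region that r by (auto simp: nP)
    qed (use r in auto)
    have "z \<in> D \<inter> ball \<zeta> r" using z \<zeta> \<delta>r by (simp add: dist_commute)
    then have "exp (- (M / c) * Re (h (P z))) \<le> squeezing_function D z"
      using bound[OF bar \<zeta>a r(1) _ r(4)] r by simp
    moreover have "1 + - (M / c) * Re (h (P z)) \<le> exp (- (M / c) * Re (h (P z)))"
      by (rule exp_ge_add_one_self)
    moreover have "M / c * Re (h (P z)) \<le> M / c * \<beta> \<delta>"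
      using M r \<zeta> z \<delta>r by (intro mult_left_mono h(4) region) (auto simp: nP dist_commute)
    ultimately show ?thesis by (simp add: \<delta>_def)
  qed
  show thesis
  proof (rule that)
    show "0 \<le> M / c" using M r by simp
    show "\<forall>\<^sub>F z in at a within D. 1 - squeezing_function D z \<le> M / c * \<beta> (boundary_dist D z)"
      unfolding eventually_at using est r R by (intro exI[of _ "min r (R/8)"]) auto
  qed
qed

theorem proposition2:
  fixes D :: "complex set" and a :: complex
  assumes "is_domain D" and "a \<in> frontier D"
  shows "(Dini_smooth_boundary_point D a \<longrightarrow>
           Limsup (at a within D)
             (\<lambda>z. ereal ((1 - squeezing_function D z) / boundary_dist D z)) < \<infinity>) \<and>
         (C1_smooth_boundary_point D a \<longrightarrow>
           (\<forall>\<alpha>::real. \<alpha> < 1 \<longrightarrow>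
             ((\<lambda>z. (1 - squeezing_function D z) / boundary_dist D z powr \<alpha>) \<longlongrightarrow> 0)
               (at a within D)))"
proof (intro conjI impI allI)
  have D: "open D" using assms by (simp add: is_domain_def)
  have pos: "0 < boundary_dist D z" if "z \<in> D" for z
    unfolding boundary_dist_def
    using that assms(2) D by (intro infdist_pos_not_in_closed) (auto simp: frontier_def interior_open)
  have inD: "\<forall>\<^sub>F z in at a within D. z \<in> D" by (auto simp: eventually_at_filter)
  {
    assume "Dini_smooth_boundary_point D a"
    then obtain U where U: "open U" "a \<in> U" and Dini: "Dini_smooth_domain (D \<inter> U)"
      by (auto simp: Dini_smooth_boundary_point_def)
    let ?G = "D \<inter> U"
    have G: "C1_smooth_bounded_domain ?G" using Dini by (simp add: Dini_smooth_domain_def)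
    have ne: "frontier ?G \<noteq> {}" using frontier_Int_open[OF D U assms(2)] by blast
    note nm = normal_modulus_bounds[OF G]
    have "summable (\<lambda>k. normal_modulus ?G ((1/2)^k))"
      using Dini nm(2,3)[OF ne] unfolding Dini_smooth_domain_def
      by (intro summable_of_Dini_integral) auto
    then have "has_small_barriers (normal_modulus ?G) (\<lambda>\<delta>. 3 * \<delta>)"
      by (intro Dini_barriers nm(2,3)[OF ne])
    then obtain C where "C \<ge> 0" and C:
      "\<forall>\<^sub>F z in at a within D. 1 - squeezing_function D z \<le> C * (3 * boundary_dist D z)"
      using nm(1) frontier_Int_open[OF D U(1)]
      by (elim squeezing_function_le_of_barriers[OF D U(1) assms(2) U(2) G zero_less_one, rotated]) auto
    from C inD have "\<forall>\<^sub>F z in at a within D.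
        ereal ((1 - squeezing_function D z) / boundary_dist D z) \<le> ereal (C * 3)"
    proof eventually_elim
      case (elim z)
      then show ?case using pos[of z] by (simp add: divide_le_eq mult.assoc)
    qed
    then have "Limsup (at a within D)
        (\<lambda>z. ereal ((1 - squeezing_function D z) / boundary_dist D z)) \<le> ereal (C * 3)"
      by (rule Limsup_bounded)
    also have "\<dots> < \<infinity>" by simp
    finally show "Limsup (at a within D)
        (\<lambda>z. ereal ((1 - squeezing_function D z) / boundary_dist D z)) < \<infinity>" .
  }
  fix \<alpha> :: real
  assume "C1_smooth_boundary_point D a" and "\<alpha> < 1"
  then obtain U where U: "open U" "a \<in> U" and G: "C1_smooth_bounded_domain (D \<inter> U)"
    by (auto simp: C1_smooth_boundary_point_def)
  let ?n = "inner_unit_normal (D \<inter> U)"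
  \<comment> \<open>Any exponent strictly between \<open>max \<alpha> 0\<close> and \<open>1\<close> will do.\<close>
  define \<beta> where "\<beta> = (max \<alpha> 0 + 1) / 2"
  have \<beta>: "0 < \<beta>" "\<beta> < 1" "\<alpha> < \<beta>" using \<open>\<alpha> < 1\<close> by (auto simp: \<beta>_def max_def)
  obtain \<epsilon> where \<epsilon>: "\<epsilon> > 0" and bar: "has_small_barriers (\<lambda>_. \<epsilon>) (\<lambda>\<delta>. \<delta> powr \<beta>)"
    using power_barriers[OF \<beta>(1,2)] by blast
  obtain V \<rho> g where V: "a \<in> V" and def: "C1_defining_function (D \<inter> U) V \<rho> g"
    using G frontier_Int_open[OF D U assms(2)] unfolding C1_smooth_bounded_domain_def by blast
  have "continuous_on V (\<lambda>x. sgn (g x))"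
    using def by (intro continuous_on_sgn) (auto simp: C1_defining_function_def)
  then have "((\<lambda>x. sgn (g x)) \<longlongrightarrow> sgn (g a)) (at a)"
    using def V by (simp add: C1_defining_function_def continuous_on_eq_continuous_at isCont_def)
  then have "((\<lambda>x. sgn (g x)) \<longlongrightarrow> sgn (g a)) (nhds a)"
    by (rule tendsto_at_iff_tendsto_nhds[where g = "\<lambda>x. sgn (g x)", THEN iffD1])
  then have "\<forall>\<^sub>F x in nhds a. dist (sgn (g x)) (sgn (g a)) < \<epsilon> / 2"
    using \<epsilon> by (intro tendstoD) auto
  moreover have "\<forall>\<^sub>F x in nhds a. x \<in> V"
    using def V by (intro eventually_nhds_in_open) (auto simp: C1_defining_function_def)
  ultimately have "\<forall>\<^sub>F x in nhds a. dist (sgn (g x)) (sgn (g a)) < \<epsilon> / 2 \<and> x \<in> V"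
    by (rule eventually_conj)
  then obtain \<eta> where \<eta>: "\<eta> > 0"
    "\<And>x. dist x a < \<eta> \<Longrightarrow> dist (sgn (g x)) (sgn (g a)) < \<epsilon> / 2 \<and> x \<in> V"
    unfolding eventually_nhds_metric by blast
  have n: "norm (?n x - ?n y) \<le> \<epsilon>"
    if "x \<in> frontier D \<inter> ball a \<eta> \<inter> U" "y \<in> frontier D \<inter> ball a \<eta> \<inter> U" for x y
  proof -
    have "?n u = - sgn (g u)" if "u \<in> frontier D \<inter> ball a \<eta> \<inter> U" for u
      using that \<eta>(2)[of u] frontier_Int_open[OF D U(1)]
      by (intro inner_unit_normal_eq[OF G def]) (auto simp: dist_commute)
    then have "norm (?n x - ?n y) = dist (sgn (g x)) (sgn (g y))"
      using that by (simp add: dist_norm norm_minus_commute)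
    also have "\<dots> \<le> dist (sgn (g x)) (sgn (g a)) + dist (sgn (g y)) (sgn (g a))"
      by (rule dist_triangle2)
    also have "\<dots> \<le> \<epsilon>" using \<eta>(2)[of x] \<eta>(2)[of y] that by (simp add: dist_commute)
    finally show ?thesis .
  qed
  obtain C where "C \<ge> 0" and C:
    "\<forall>\<^sub>F z in at a within D. 1 - squeezing_function D z \<le> C * (boundary_dist D z powr \<beta>)"
    using squeezing_function_le_of_barriers[OF D U(1) assms(2) U(2) G \<eta>(1) n bar] by blast
  have lim: "((\<lambda>z. C * boundary_dist D z powr (\<beta> - \<alpha>)) \<longlongrightarrow> 0) (at a within D)"
  proof -
    have "((\<lambda>z. boundary_dist D z) \<longlongrightarrow> infdist a (frontier D)) (at a within D)"
      unfolding boundary_dist_def by (intro tendsto_infdist tendsto_ident_at)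
    then have "((\<lambda>z. boundary_dist D z) \<longlongrightarrow> 0) (at a within D)"
      using assms(2) by simp
    then have "((\<lambda>z. boundary_dist D z powr (\<beta> - \<alpha>)) \<longlongrightarrow> 0) (at a within D)"
      using \<beta> by (intro tendsto_zero_powrI[where b = "\<beta> - \<alpha>"])
        (auto simp: boundary_dist_def infdist_nonneg)
    then show ?thesis by (rule tendsto_mult_right_zero)
  qed
  show "((\<lambda>z. (1 - squeezing_function D z) / boundary_dist D z powr \<alpha>) \<longlongrightarrow> 0) (at a within D)"
  proof (rule tendsto_sandwich[OF _ _ tendsto_const lim])
    show "\<forall>\<^sub>F z in at a within D. 0 \<le> (1 - squeezing_function D z) / boundary_dist D z powr \<alpha>"
      using inD by eventually_elim (simp add: squeezing_function_le_1[OF D])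
    show "\<forall>\<^sub>F z in at a within D. (1 - squeezing_function D z) / boundary_dist D z powr \<alpha>
        \<le> C * boundary_dist D z powr (\<beta> - \<alpha>)"
      using C inD
    proof eventually_elim
      case (elim z)
      then have "0 < boundary_dist D z powr \<alpha>" using pos[of z] by simp
      then show ?case using elim pos[of z] by (simp add: powr_diff divide_right_mono)
    qed
  qed
qed

end
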